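(* Let $H$ be a separable Hilbert space, let $(X_t)_{t\geq 1}$ be $H$-valued and $(\epsilon_t)_{t\geq1}$ real-valued, and $(\mathcal{F}_t)_{t\geq 0}$ a filtration such that for all $t\ge1$: $X_t$ is $\mathcal{F}_{t-1}$-measurable, $\epsilon_t$ is $\mathcal{F}_t$-measurable, $\mathbb{E}[\epsilon_t\mid\mathcal{F}_{t-1}]=0$, $|\epsilon_t|\le B$, and $\mathrm{Var}(\epsilon_t\mid\mathcal{F}_{t-1})=\sigma^2$ for a constant $\sigma^2$. Fix $\rho>0$ and set $V_t=\sum_{i\leq t}X_iX_i^T$, $M_t=\sum_{i\le t}X_i\epsilon_i$, $G_t=(\rho I+V_t)^{-1/2}X_t$. Let $\delta_1,\delta_2>0$ with $\delta_1+\delta_2<1$, and let $(\hat\sigma^2_{u,t,\delta_1})_t$ be random variables such that $\mathbb{P}(\hat\sigma^2_{u,t,\delta_1}\ge\sigma^2 \text{ for all } t)\ge1-\delta_1$. Set $$s_t=\|(\rho I+V_t)^{-1/2}M_t\|,\qquad \hat\nu_t=\hat\sigma^2_{u,t,\delta_1}\sum_{i\le t}\|G_i\|^2.$$ Then for every $\theta>0$, $$\mathbb{P}\left(\sup_t \frac{(\theta/B^2)^{\theta/B^2}}{\Gamma(\theta/B^2)\,\overline{\gamma}(\theta/B^2,\theta/B^2)}\cdot\frac{\Gamma\big(\frac{Bs_t+\hat\nu_t+\theta}{B^2}\big)\,\overline{\gamma}\big(\frac{Bs_t+\hat\nu_t+\theta}{B^2},\frac{\hat\nu_t+\theta}{B^2}\big)}{\big(\frac{\hat\nu_t+\theta}{B^2}\big)^{\frac{Bs_t+\hat\nu_t+\theta}{B^2}}}\exp\Big(\frac{\hat\nu_t}{B^2}\Big)<\frac{2}{\delta_2}\right)\ge1-\delta_1-\delta_2,$$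 where $\overline{\gamma}(a,x)=\frac{1}{\Gamma(a)}\int_x^\infty u^{a-1}e^{-u}\,du$ is the regularized upper incomplete gamma function.
   Context: For $f,g\in H$, $fg^T$ denotes the operator $f\langle g,\cdot\rangle$ on $H$, and $I$ is the identity operator on $H$. *)

theory Defs
  imports "HOL-Probability.Probability"
begin

definition reg_upper_gamma :: "real \<Rightarrow> real \<Rightarrow> real" where
  "reg_upper_gamma a x =
     (1 / Gamma a) * set_lebesgue_integral lborel {x..} (\<lambda>u. u powr (a - 1) * exp (- u))"

text \<open>The operator A^(-1/2) for a positive invertible operator A on a real Hilbert space:
  the (unique) bounded, self-adjoint, positive operator S with S o S = A^(-1).\<close>
definition op_inv_sqrt :: "('h::real_inner \<Rightarrow> 'h) \<Rightarrow> ('h \<Rightarrow> 'h)" where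
  "op_inv_sqrt A = (THE S. bounded_linear S
      \<and> (\<forall>x y. inner (S x) y = inner x (S y))
      \<and> (\<forall>x. 0 \<le> inner (S x) x)
      \<and> (\<forall>x. S (S (A x)) = x)
      \<and> (\<forall>x. A (S (S x)) = x))"

definition outer :: "'h::real_inner \<Rightarrow> 'h \<Rightarrow> ('h \<Rightarrow> 'h)" where
  "outer f g = (\<lambda>x. inner g x *\<^sub>R f)"

end

theory Submission
  imports Defs
begin

text \<open>
  Write \<open>W\<^sub>t = \<rho> I + V\<^sub>t\<close>, which is \<open>F (t - 1)\<close>-measurable. Since \<open>W\<^sub>t\<close> increases, \<open>s\<^sub>t\<close> is the norm of
  \<open>u + \<epsilon>\<^sub>t G\<^sub>t\<close> for a predictable \<open>u\<close> with \<open>|u| \<le> s\<^bsub>t-1\<^esub>\<close> and \<open>|G\<^sub>t| \<le> 1\<close>. Pinelis' inequality for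
  \<open>cosh (\<lambda> |u + h|)\<close> together with a Bennett bound on the remainder makes
  \<open>cosh (\<lambda> s\<^sub>t) exp (- \<sigma>\<^sup>2 (exp (\<lambda> B) - 1 - \<lambda> B) / B\<^sup>2 \<Sum>\<^sub>i |G\<^sub>i|\<^sup>2)\<close> a supermartingale for each \<open>\<lambda> \<ge> 0\<close>.
  Mixing over \<open>v = exp (\<lambda> B) \<ge> 1\<close> with density proportional to \<open>v powr (b - 1) * exp (- b v)\<close>,
  where \<open>b = \<theta> / B\<^sup>2\<close>, turns it into the incomplete gamma expression up to the factor 2 from
  \<open>exp y \<le> 2 cosh y\<close>. Ville's inequality bounds the running supremum, and on the event
  \<open>\<sigma>hat \<ge> \<sigma>\<^sup>2\<close> replacing the variance by its estimate only decreases the mixture.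
\<close>

section \<open>Square roots of coercive operators\<close>

text \<open>Picard iteration started at 0: every iterate is a polynomial in \<open>T\<close>, so
  symmetry and commutation pass from \<open>T\<close> to all iterates.\<close>

primrec sqrt_iter :: "('h::real_normed_vector \<Rightarrow> 'h) \<Rightarrow> nat \<Rightarrow> 'h \<Rightarrow> 'h" where
  "sqrt_iter T 0 = (\<lambda>x. 0)"
| "sqrt_iter T (Suc n) = (\<lambda>x. (1/2) *\<^sub>R (T x + sqrt_iter T n (sqrt_iter T n x)))"

lemma linear_sqrt_iter:
  assumes "linear T"
  shows "linear (sqrt_iter T n)"
proof (induction n)
  case 0
  show ?case by (simp add: linear_iff)
next
  case (Suc n)
  then show ?case
    using assms by (simp add: linear_iff algebra_simps)
qed

lemma sqrt_iter_symmetric: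
  assumes "\<And>x y. inner (T x) y = inner x (T y)"
  shows "inner (sqrt_iter T n x) y = inner x (sqrt_iter T n y)"
  using assms by (induction n arbitrary: x y) (simp_all add: inner_add_left inner_add_right)

lemma sqrt_iter_commute:
  assumes "linear Q" and "\<And>x. Q (T x) = T (Q x)"
  shows "Q (sqrt_iter T n x) = sqrt_iter T n (Q x)"
  using assms by (induction n arbitrary: x) (simp_all add: linear_iff linear_0)

text \<open>\<open>r\<close> is a fixed point of the scalar majorant
  \<open>r = (q + r^2) / 2\<close>, so the iteration maps the ball of radius \<open>r\<close> into
  itself.\<close>

lemma norm_sqrt_iter_le:
  assumes T: "\<And>x. norm (T x) \<le> q * norm x" and r: "q + r\<^sup>2 = 2 * r" "0 \<le> r"
  shows "norm (sqrt_iter T n x) \<le> r * norm x"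
proof (induction n arbitrary: x)
  case 0
  then show ?case using r by simp
next
  case (Suc n)
  have "norm (sqrt_iter T n (sqrt_iter T n x)) \<le> r * (r * norm x)"
    using Suc[of "sqrt_iter T n x"] Suc[of x] r(2) by (meson mult_left_mono order_trans)
  then have "norm (T x + sqrt_iter T n (sqrt_iter T n x)) \<le> q * norm x + r * (r * norm x)"
    using T[of x] norm_triangle_ineq[of "T x" "sqrt_iter T n (sqrt_iter T n x)"] by linarith
  also have "\<dots> = 2 * (r * norm x)"
    using arg_cong[OF r(1), of "\<lambda>c. c * norm x"] by (simp add: power2_eq_square algebra_simps)
  finally show ?case by simp
qed

text \<open>For consecutive iterates, \<open>P^2 - R^2 = P (P - R) + (P - R) R\<close>. The outer
  factors have norm at most \<open>r\<close> and the 1/2 averages the two terms, so increments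
  shrink by \<open>r\<close>.\<close>

lemma norm_sqrt_iter_diff_le:
  assumes "linear T" and T: "\<And>x. norm (T x) \<le> q * norm x" and r: "q + r\<^sup>2 = 2 * r" "0 \<le> r"
  shows "norm (sqrt_iter T (Suc n) x - sqrt_iter T n x) \<le> r ^ n * (r * norm x)"
proof (induction n arbitrary: x)
  case 0
  then show ?case using norm_sqrt_iter_le[OF T r, of "Suc 0" x] by simp
next
  case (Suc n)
  let ?P = "sqrt_iter T (Suc n)" and ?R = "sqrt_iter T n"
  have lin: "linear ?P" by (rule linear_sqrt_iter[OF assms(1)])
  have "sqrt_iter T (Suc (Suc n)) x - ?P x = (1/2) *\<^sub>R (?P (?P x - ?R x) + (?P (?R x) - ?R (?R x)))"
    using linear_diff[OF lin, of "?P x" "?R x"]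
    by (simp add: scaleR_diff_right[symmetric] del: sqrt_iter.simps(2)) (simp add: algebra_simps)
  then have "2 * norm (sqrt_iter T (Suc (Suc n)) x - ?P x)
      \<le> norm (?P (?P x - ?R x)) + norm (?P (?R x) - ?R (?R x))"
    using norm_triangle_ineq[of "?P (?P x - ?R x)" "?P (?R x) - ?R (?R x)"]
    by (simp only: norm_scaleR)
  moreover have "norm (?P (?P x - ?R x)) \<le> r * (r ^ n * (r * norm x))"
    using order_trans[OF norm_sqrt_iter_le[OF T r] mult_left_mono[OF Suc r(2)]] .
  moreover have "norm (?P (?R x) - ?R (?R x)) \<le> r ^ n * (r * (r * norm x))"
    using order_trans[OF Suc mult_left_mono[OF mult_left_mono[OF norm_sqrt_iter_le[OF T r] r(2)]
      zero_le_power[OF r(2)]]] .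
  ultimately have "2 * norm (sqrt_iter T (Suc (Suc n)) x - ?P x)
      \<le> r * (r ^ n * (r * norm x)) + r ^ n * (r * (r * norm x))"
    by linarith
  then show ?case
    by (simp only: power_Suc mult.assoc mult.left_commute)
qed

lemma Cauchy_geometric_steps:
  fixes f :: "nat \<Rightarrow> 'a::real_normed_vector"
  assumes step: "\<And>n. norm (f (Suc n) - f n) \<le> r ^ n * c" and r: "0 \<le> r" "r < 1"
  shows "Cauchy f"
proof -
  define a where "a n = (\<Sum>k<n. r ^ k * c)" for n
  have le: "norm (f (m + k) - f m) \<le> a (m + k) - a m" for m k
  proof (induction k)
    case 0
    then show ?case by simp
  next
    case (Suc k)
    have "norm (f (m + Suc k) - f m) \<le> norm (f (Suc (m + k)) - f (m + k)) + norm (f (m + k) - f m)"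
      using norm_triangle_ineq[of "f (Suc (m + k)) - f (m + k)" "f (m + k) - f m"] by simp
    also have "\<dots> \<le> a (m + Suc k) - a m"
      using Suc step[of "m + k"] by (simp add: a_def)
    finally show ?case .
  qed
  have "summable (\<lambda>k. r ^ k * c)"
    using r by (intro summable_mult2 summable_geometric) simp
  then have "Cauchy a"
    unfolding a_def by (simp add: summable_iff_convergent Cauchy_convergent_iff)
  have ge: "dist (f n) (f m) \<le> dist (a n) (a m)" if "m \<le> n" for m n
    using le[of m "n - m"] that by (simp add: dist_norm)
  show ?thesis
  proof (rule metric_CauchyI)
    fix e :: real assume "e > 0"
    then obtain N where N: "\<And>m n. m \<ge> N \<Longrightarrow> n \<ge> N \<Longrightarrow> dist (a m) (a n) < e"
      using metric_CauchyD[OF \<open>Cauchy a\<close>] by blast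
    have "dist (f m) (f n) < e" if "m \<ge> N" "n \<ge> N" for m n
      using N[OF that] ge[of m n] ge[of n m]
      by (metis dist_commute le_cases order.strict_trans1)
    then show "\<exists>N. \<forall>m\<ge>N. \<forall>n\<ge>N. dist (f m) (f n) < e" by blast
  qed
qed

text \<open>For symmetric \<open>T\<close> with norm \<open>q < 1\<close>, the iteration \<open>P \<mapsto> (T + P\<^sup>2) / 2\<close> contracts the ball of
  radius \<open>1 - sqrt (1 - q)\<close>; its fixed point satisfies \<open>(I - P)\<^sup>2 = I - T\<close> and commutes with
  everything that commutes with \<open>T\<close>.\<close>

lemma ex_sqrt_iter_limit:
  fixes T :: "'h::{real_inner, complete_space} \<Rightarrow> 'h"
  assumes lin: "linear T" and sym: "\<And>x y. inner (T x) y = inner x (T y)"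
    and T: "\<And>x. norm (T x) \<le> q * norm x" and q: "0 \<le> q" "q < 1"
  obtains P r where "linear P" "0 \<le> r" "r < 1" "\<And>x. norm (P x) \<le> r * norm x"
    "\<And>x y. inner (P x) y = inner x (P y)"
    "\<And>x. 2 *\<^sub>R P x = T x + P (P x)"
    "\<forall>Q. bounded_linear Q \<longrightarrow> (\<forall>x. Q (T x) = T (Q x)) \<longrightarrow> (\<forall>x. Q (P x) = P (Q x))"
proof -
  \<comment> \<open>The smaller root of \<open>r^2 - 2 r + q = 0\<close>; it is below 1 because
    \<open>q < 1\<close>.\<close>
  define r where "r = 1 - sqrt (1 - q)"
  have r: "q + r\<^sup>2 = 2 * r" "0 \<le> r" "r < 1"
    using q by (simp_all add: r_def power2_diff)
  let ?p = "sqrt_iter T"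
  have "convergent (\<lambda>n. ?p n x)" for x
    using norm_sqrt_iter_diff_le[OF lin T r(1,2)] r(2,3)
    by (intro Cauchy_convergent Cauchy_geometric_steps)
  then obtain P where P: "\<And>x. (\<lambda>n. ?p n x) \<longlonglongrightarrow> P x"
    unfolding convergent_def by metis
  have pl: "linear (?p n)" for n by (rule linear_sqrt_iter[OF lin])
  have Pl: "linear P"
  proof (rule linearI)
    show "P (x + y) = P x + P y" for x y
      using LIMSEQ_unique[OF P[of "x + y"]] tendsto_add[OF P[of x] P[of y]]
      by (simp add: linear_add[OF pl])
    show "P (c *\<^sub>R x) = c *\<^sub>R P x" for c x
      using LIMSEQ_unique[OF P[of "c *\<^sub>R x"]] tendsto_scaleR[OF tendsto_const P[of x]]
      by (simp add: linear_cmul[OF pl])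
  qed
  have Pn: "norm (P x) \<le> r * norm x" for x
    by (rule LIMSEQ_le_const2[OF tendsto_norm[OF P]]) (use norm_sqrt_iter_le[OF T r(1,2)] in blast)
  have Ps: "inner (P x) y = inner x (P y)" for x y
    using LIMSEQ_unique[OF tendsto_inner[OF P[of x] tendsto_const[of y]]]
      tendsto_inner[OF tendsto_const[of x] P[of y]]
    by (simp add: sqrt_iter_symmetric[OF sym])
  \<comment> \<open>Pointwise convergence alone does not pass to compositions; the uniform bound
    \<open>r\<close> on the iterates makes \<open>?p n (?p n x - P x)\<close> vanish.\<close>
  have PP: "(\<lambda>n. ?p n (?p n x)) \<longlonglongrightarrow> P (P x)" for x
  proof -
    have "(\<lambda>n. ?p n (?p n x - P x)) \<longlonglongrightarrow> 0"
    proof (rule Lim_null_comparison)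
      show "\<forall>\<^sub>F n in sequentially. norm (?p n (?p n x - P x)) \<le> r * norm (?p n x - P x)"
        using norm_sqrt_iter_le[OF T r(1,2)] by simp
      show "(\<lambda>n. r * norm (?p n x - P x)) \<longlonglongrightarrow> 0"
        using P[of x] by (auto intro!: tendsto_mult_right_zero tendsto_norm_zero simp: LIM_zero_iff)
    qed
    from tendsto_add[OF this P[of "P x"]] show ?thesis
      by (simp add: linear_diff[OF pl])
  qed
  have Pf: "2 *\<^sub>R P x = T x + P (P x)" for x
  proof -
    have "(\<lambda>n. 2 *\<^sub>R ?p (Suc n) x) \<longlonglongrightarrow> 2 *\<^sub>R P x"
      using P[of x] by (intro tendsto_intros LIMSEQ_Suc)
    moreover have "(\<lambda>n. 2 *\<^sub>R ?p (Suc n) x) \<longlonglongrightarrow> T x + P (P x)"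
      using tendsto_add[OF tendsto_const PP] by simp
    ultimately show ?thesis by (rule LIMSEQ_unique)
  qed
  have Pc: "Q (P x) = P (Q x)" if "bounded_linear Q" "\<And>x. Q (T x) = T (Q x)" for Q x
    using LIMSEQ_unique[OF bounded_linear.tendsto[OF that(1) P[of x]]] P[of "Q x"]
    by (simp add: sqrt_iter_commute[where T = T, OF bounded_linear.linear[OF that(1)] that(2)])
  show ?thesis
    by (rule that[OF Pl r(2,3) Pn Ps Pf]) (use Pc in blast)
qed

text \<open>A suitable scaling makes \<open>T = I - A / c\<close> a strict contraction, so
  \<open>sqrt c (I - P)\<close> squares to \<open>A\<close>. A rival root \<open>R\<close> commutes
  with \<open>A = R^2\<close>, hence with \<open>P\<close> and \<open>S\<close>, and coercivity of
  \<open>S\<close> forces \<open>R = S\<close>.\<close>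

lemma ex1_positive_sqrt:
  fixes A :: "'h::{real_inner, complete_space} \<Rightarrow> 'h"
  assumes A: "bounded_linear A" and sym: "\<And>x y. inner (A x) y = inner x (A y)"
    and coercive: "\<And>x. m * (norm x)\<^sup>2 \<le> inner (A x) x" and m: "m > 0"
  shows "\<exists>!S. bounded_linear S \<and> (\<forall>x y. inner (S x) y = inner x (S y))
    \<and> (\<forall>x. 0 \<le> inner (S x) x) \<and> (\<forall>x. S (S x) = A x)"
proof -
  interpret A: bounded_linear A by fact
  obtain K0 where K0: "\<And>x. norm (A x) \<le> norm x * K0" using A.bounded by blast
  define K where "K = max K0 m"
  have K: "norm (A x) \<le> K * norm x" for x
    using K0[of x] by (smt (verit) K_def max_def mult.commute mult_right_mono norm_ge_zero)
  have Kpos: "K > 0" "m \<le> K" using m by (auto simp: K_def)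
  \<comment> \<open>This \<open>c\<close> minimises \<open>1 - 2 m / c + K^2 / c^2\<close>, the
    bound on \<open>|T x|^2 / |x|^2\<close>; the minimum is
    \<open>1 - (m / K)^2 = q^2\<close>.\<close>
  define c where "c = K\<^sup>2 / m"
  have c: "c > 0" using Kpos m by (simp add: c_def)
  define T where "T x = x - (1/c) *\<^sub>R A x" for x
  define q where "q = sqrt (1 - (m / K)\<^sup>2)"
  have mK: "(m / K)\<^sup>2 \<le> 1" using m Kpos by (simp add: power_le_one)
  have q: "0 \<le> q" "q < 1" using m Kpos mK by (auto simp: q_def)
  have Tl: "linear T"
    by (simp add: linear_iff T_def A.add A.scaleR algebra_simps)
  have Ts: "inner (T x) y = inner x (T y)" for x y
    by (simp add: T_def inner_diff_left inner_diff_right sym)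
  have Tn: "norm (T x) \<le> q * norm x" for x
  proof -
    have "(norm (T x))\<^sup>2 = (norm x)\<^sup>2 - 2 / c * inner (A x) x + (norm (A x))\<^sup>2 / c\<^sup>2"
      unfolding T_def power2_norm_eq_inner
      by (simp add: inner_diff_left inner_diff_right inner_commute power2_eq_square field_simps)
    also have "\<dots> \<le> (norm x)\<^sup>2 - 2 / c * (m * (norm x)\<^sup>2) + (K * norm x)\<^sup>2 / c\<^sup>2"
      using c coercive[of x] K[of x]
      by (intro add_mono diff_mono mult_left_mono divide_right_mono power_mono) auto
    also have "\<dots> = (q * norm x)\<^sup>2"
      using c m Kpos mK by (simp add: q_def c_def power_mult_distrib power2_eq_square field_simps)
    finally show ?thesis
      by (rule power2_le_imp_le) (use q in auto)
  qed
  obtain P r where P: "linear P" "0 \<le> r" "r < 1" "\<And>x. norm (P x) \<le> r * norm x"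
    "\<And>x y. inner (P x) y = inner x (P y)"
    "\<And>x. 2 *\<^sub>R P x = T x + P (P x)"
    "\<forall>Q. bounded_linear Q \<longrightarrow> (\<forall>x. Q (T x) = T (Q x)) \<longrightarrow> (\<forall>x. Q (P x) = P (Q x))"
    by (rule ex_sqrt_iter_limit[OF Tl Ts Tn q]) (rule that)
  define S where "S x = sqrt c *\<^sub>R (x - P x)" for x
  have "bounded_linear P"
    using P(1,4) by (intro bounded_linear_intro[where K = r]) (auto simp: linear_iff mult.commute)
  then have Sb: "bounded_linear S"
    unfolding S_def by (intro bounded_linear_const_scaleR bounded_linear_sub bounded_linear_ident)
  have Ss: "inner (S x) y = inner x (S y)" for x y
    by (simp add: S_def inner_diff_left inner_diff_right P(5))
  have Sp: "sqrt c * (1 - r) * (norm x)\<^sup>2 \<le> inner (S x) x" for x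
  proof -
    have "inner (P x) x \<le> norm (P x) * norm x" by (rule norm_cauchy_schwarz)
    also have "\<dots> \<le> r * norm x * norm x" by (intro mult_right_mono P) simp
    finally have "(1 - r) * (norm x)\<^sup>2 \<le> inner (x - P x) x"
      by (simp add: inner_diff_left power2_norm_eq_inner[symmetric] power2_eq_square algebra_simps)
    then show ?thesis using c by (simp add: S_def mult.assoc)
  qed
  have Sp0: "0 \<le> inner (S x) x" for x
    using Sp[of x] P(2,3) c by (smt (verit) mult_nonneg_nonneg real_sqrt_ge_zero zero_le_power2)
  have SS: "S (S x) = A x" for x
  proof -
    have "S (S x) = c *\<^sub>R (x - P x - P (x - P x))"
      using c by (simp add: S_def linear_cmul[OF P(1)] scaleR_diff_right[symmetric])
    also have "\<dots> = c *\<^sub>R (x - (2 *\<^sub>R P x - P (P x)))"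
      by (simp add: linear_diff[OF P(1)] scaleR_2 algebra_simps)
    also have "\<dots> = c *\<^sub>R (x - T x)"
      by (simp add: P(6))
    also have "\<dots> = A x" using c by (simp add: T_def)
    finally show ?thesis .
  qed
  show ?thesis
  proof (rule ex1I[of _ S])
    show "bounded_linear S \<and> (\<forall>x y. inner (S x) y = inner x (S y))
      \<and> (\<forall>x. 0 \<le> inner (S x) x) \<and> (\<forall>x. S (S x) = A x)"
      using Sb Ss Sp0 SS by blast
  next
    fix R assume R: "bounded_linear R \<and> (\<forall>x y. inner (R x) y = inner x (R y))
      \<and> (\<forall>x. 0 \<le> inner (R x) x) \<and> (\<forall>x. R (R x) = A x)"
    then interpret R: bounded_linear R by blast
    interpret S: bounded_linear S by fact
    have RA: "R (A x) = A (R x)" for x using R by metis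
    have "R (T x) = T (R x)" for x
      by (simp add: T_def R.diff R.scaleR RA)
    then have "R (P x) = P (R x)" for x using R P(7) by blast
    then have RS: "R (S x) = S (R x)" for x
      by (simp add: S_def R.diff R.scaleR)
    show "R = S"
    proof
      fix x
      \<comment> \<open>Commutation gives \<open>(S + R) z = S^2 x - R^2 x = 0\<close>; pairing with
        \<open>z\<close> excludes \<open>z\<close> nonzero, since \<open>S\<close> is coercive and
        \<open>R\<close> positive.\<close>
      define z where "z = S x - R x"
      have "S z + R z = 0"
        using R SS RS[of x] by (simp add: z_def S.diff R.diff)
      then have "inner (S z) z + inner (R z) z = 0"
        by (metis inner_add_left inner_zero_left)
      moreover have "0 \<le> inner (R z) z" using R by blast
      ultimately have "inner (S z) z \<le> 0" by linarith
      then have "sqrt c * (1 - r) * (norm z)\<^sup>2 \<le> 0" using Sp[of z] by linarith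
      moreover have "sqrt c * (1 - r) > 0" using c P(3) by simp
      ultimately have "(norm z)\<^sup>2 \<le> 0" by (meson mult_pos_pos not_le)
      then show "R x = S x" by (simp add: z_def)
    qed
  qed
qed

section \<open>The regularised covariance operator\<close>

definition reg_op :: "real \<Rightarrow> (nat \<Rightarrow> 'h::real_inner) \<Rightarrow> nat \<Rightarrow> 'h \<Rightarrow> 'h" where
  "reg_op \<rho> x k = (\<lambda>y. \<rho> *\<^sub>R y + (\<Sum>i\<in>{1..k}. outer (x i) (x i) y))"

text \<open>The inverse of \<^const>\<open>reg_op\<close> in Sherman--Morrison form, whose measurability in \<open>x\<close> is immediate.\<close>

primrec reg_inv :: "real \<Rightarrow> (nat \<Rightarrow> 'h::real_inner) \<Rightarrow> nat \<Rightarrow> 'h \<Rightarrow> 'h" where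
  "reg_inv \<rho> x 0 y = (1 / \<rho>) *\<^sub>R y"
| "reg_inv \<rho> x (Suc k) y = reg_inv \<rho> x k y
    - (inner (x (Suc k)) (reg_inv \<rho> x k y) / (1 + inner (x (Suc k)) (reg_inv \<rho> x k (x (Suc k)))))
        *\<^sub>R reg_inv \<rho> x k (x (Suc k))"

context
  fixes \<rho> :: real and x :: "nat \<Rightarrow> 'h::real_inner"
  assumes \<rho>: "\<rho> > 0"
begin

lemma reg_op_Suc: "reg_op \<rho> x (Suc k) y = reg_op \<rho> x k y + inner (x (Suc k)) y *\<^sub>R x (Suc k)"
  by (simp add: reg_op_def outer_def)

lemma bounded_linear_reg_op: "bounded_linear (reg_op \<rho> x k)"
  unfolding reg_op_def outer_def
  by (intro bounded_linear_add bounded_linear_sum bounded_linear_scaleR_left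
      bounded_linear_scaleR_right bounded_linear_const_scaleR bounded_linear_ident
      bounded_linear_scaleR_const bounded_linear_inner_right)

lemma reg_op_symmetric: "inner (reg_op \<rho> x k y) z = inner y (reg_op \<rho> x k z)"
  by (simp add: reg_op_def outer_def inner_add_left inner_add_right inner_sum_left inner_sum_right
      inner_commute mult.commute)

lemma reg_op_coercive: "\<rho> * (norm y)\<^sup>2 \<le> inner (reg_op \<rho> x k y) y"
  by (simp add: reg_op_def outer_def inner_add_left inner_sum_left power2_norm_eq_inner sum_nonneg)

lemma reg_op_inverse: "reg_op \<rho> x k (reg_inv \<rho> x k y) = y"
proof (induction k arbitrary: y)
  case 0
  then show ?case using \<rho> by (simp add: reg_op_def)
next
  case (Suc k)
  let ?x = "x (Suc k)"
  interpret W: bounded_linear "reg_op \<rho> x k" by (rule bounded_linear_reg_op)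
  define \<alpha> where "\<alpha> = inner ?x (reg_inv \<rho> x k ?x)"
  define \<beta> where "\<beta> = inner ?x (reg_inv \<rho> x k y)"
  \<comment> \<open>Coercivity of the previous operator keeps the Sherman--Morrison denominator
    \<open>1 + \<alpha>\<close> away from 0.\<close>
  have "0 \<le> \<rho> * (norm (reg_inv \<rho> x k ?x))\<^sup>2" using \<rho> by simp
  also have "\<dots> \<le> \<alpha>"
    using reg_op_coercive[of "reg_inv \<rho> x k ?x" k] by (simp add: \<alpha>_def Suc)
  finally have \<alpha>: "\<alpha> \<ge> 0" .
  have "reg_op \<rho> x (Suc k) (reg_inv \<rho> x (Suc k) y)
      = y - (\<beta> / (1 + \<alpha>)) *\<^sub>R ?x + (\<beta> - \<beta> / (1 + \<alpha>) * \<alpha>) *\<^sub>R ?x"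
    by (simp add: reg_op_Suc W.diff W.scaleR Suc inner_diff_right \<alpha>_def[symmetric] \<beta>_def[symmetric])
  also have "\<beta> - \<beta> / (1 + \<alpha>) * \<alpha> = \<beta> / (1 + \<alpha>)"
    using \<alpha> by (simp add: field_simps)
  finally show ?case by simp
qed

text \<open>A right inverse of an injective operator is two-sided; injectivity is
  coercivity.\<close>

lemma reg_inv_inverse: "reg_inv \<rho> x k (reg_op \<rho> x k y) = y"
proof -
  interpret W: bounded_linear "reg_op \<rho> x k" by (rule bounded_linear_reg_op)
  define d where "d = reg_inv \<rho> x k (reg_op \<rho> x k y) - y"
  have "reg_op \<rho> x k d = 0" by (simp add: d_def W.diff reg_op_inverse)
  then have "\<rho> * (norm d)\<^sup>2 \<le> 0" using reg_op_coercive[of d k] by simp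
  then have "d = 0" using \<rho> by (simp add: mult_le_0_iff)
  then show ?thesis by (simp add: d_def)
qed

lemma reg_inv_symmetric: "inner (reg_inv \<rho> x k y) z = inner y (reg_inv \<rho> x k z)"
  by (metis reg_op_inverse reg_op_symmetric)

lemma bounded_linear_reg_inv: "bounded_linear (reg_inv \<rho> x k)"
proof (rule bounded_linear_intro)
  interpret W: bounded_linear "reg_op \<rho> x k" by (rule bounded_linear_reg_op)
  show "reg_inv \<rho> x k (y + z) = reg_inv \<rho> x k y + reg_inv \<rho> x k z" for y z
    by (metis W.add reg_op_inverse reg_inv_inverse)
  show "reg_inv \<rho> x k (c *\<^sub>R y) = c *\<^sub>R reg_inv \<rho> x k y" for c y
    by (metis W.scaleR reg_op_inverse reg_inv_inverse)
  show "norm (reg_inv \<rho> x k y) \<le> norm y * (1 / \<rho>)" for y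
  proof -
    let ?z = "reg_inv \<rho> x k y"
    have "\<rho> * (norm ?z)\<^sup>2 \<le> norm y * norm ?z"
      using reg_op_coercive[of ?z k] norm_cauchy_schwarz[of y ?z] by (simp add: reg_op_inverse)
    then have "\<rho> * norm ?z \<le> norm y"
      by (cases "norm ?z = 0") (auto simp: power2_eq_square)
    then show ?thesis using \<rho> by (simp add: field_simps)
  qed
qed

lemma reg_inv_nonneg: "0 \<le> inner y (reg_inv \<rho> x k y)"
proof -
  have "0 \<le> \<rho> * (norm (reg_inv \<rho> x k y))\<^sup>2" using \<rho> by simp
  also have "\<dots> \<le> inner y (reg_inv \<rho> x k y)"
    using reg_op_coercive[of "reg_inv \<rho> x k y" k] by (simp add: reg_op_inverse)
  finally show ?thesis .
qed

text \<open>Needed to take a square root of the inverse. If \<open>K\<close> bounds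
  \<open>reg_op\<close>, the preimage \<open>z\<close> of \<open>y\<close> has
  \<open>|z| >= |y| / K\<close>, and coercivity of \<open>reg_op\<close> at \<open>z\<close> yields
  \<open>\<rho> / K^2\<close>.\<close>

lemma reg_inv_coercive:
  obtains m where "m > 0" "\<And>y. m * (norm y)\<^sup>2 \<le> inner (reg_inv \<rho> x k y) y"
proof -
  interpret W: bounded_linear "reg_op \<rho> x k" by (rule bounded_linear_reg_op)
  obtain K where K: "K > 0" "\<And>y. norm (reg_op \<rho> x k y) \<le> norm y * K"
    using W.pos_bounded by blast
  have "\<rho> / K\<^sup>2 * (norm y)\<^sup>2 \<le> inner (reg_inv \<rho> x k y) y" for y
  proof -
    let ?z = "reg_inv \<rho> x k y"
    have "(norm y)\<^sup>2 \<le> (norm ?z * K)\<^sup>2"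
      using K(2)[of ?z] by (intro power_mono) (auto simp: reg_op_inverse)
    then have "\<rho> / K\<^sup>2 * (norm y)\<^sup>2 \<le> \<rho> * (norm ?z)\<^sup>2"
      using \<rho> K(1) by (simp add: field_simps power_mult_distrib)
    also have "\<dots> \<le> inner ?z y"
      using reg_op_coercive[of ?z k] by (simp add: reg_op_inverse inner_commute)
    finally show ?thesis .
  qed
  then show ?thesis using that[of "\<rho> / K\<^sup>2"] \<rho> K(1) by simp
qed

text \<open>By symmetry the Sherman--Morrison correction to the quadratic form is a square over a
  positive number.\<close>

lemma reg_inv_Suc_le: "inner y (reg_inv \<rho> x (Suc k) y) \<le> inner y (reg_inv \<rho> x k y)"
proof -
  have "inner y (reg_inv \<rho> x k (x (Suc k))) = inner (x (Suc k)) (reg_inv \<rho> x k y)"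
    by (metis inner_commute reg_inv_symmetric)
  then show ?thesis
    using reg_inv_nonneg[of "x (Suc k)" k] by (simp add: inner_diff_right)
qed

text \<open>If the form at the new vector is \<open>\<alpha>\<close> before the update, it is
  \<open>\<alpha> / (1 + \<alpha>)\<close> after it.\<close>

lemma reg_inv_self_le_1: "inner (x (Suc k)) (reg_inv \<rho> x (Suc k) (x (Suc k))) \<le> 1"
proof -
  define \<alpha> where "\<alpha> = inner (x (Suc k)) (reg_inv \<rho> x k (x (Suc k)))"
  have \<alpha>: "\<alpha> \<ge> 0" unfolding \<alpha>_def by (rule reg_inv_nonneg)
  have "inner (x (Suc k)) (reg_inv \<rho> x (Suc k) (x (Suc k))) = \<alpha> - \<alpha> / (1 + \<alpha>) * \<alpha>"
    by (simp add: inner_diff_right \<alpha>_def[symmetric])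
  also have "\<dots> \<le> 1" using \<alpha> by (simp add: field_simps)
  finally show ?thesis .
qed

end

text \<open>The two inverse conditions in the definite description amount to
  \<open>S (S x) = reg_inv \<rho> x k x\<close>, so the unique positive root of
  \<open>reg_inv\<close> resolves it. Afterwards only linearity and this inner product formula are
  used.\<close>

lemma op_inv_sqrt_reg_op:
  fixes x :: "nat \<Rightarrow> 'h::{real_inner, complete_space}" and k :: nat
  assumes \<rho>: "\<rho> > 0"
  defines "S \<equiv> op_inv_sqrt (reg_op \<rho> x k)"
  shows "linear S" and "inner (S y) (S z) = inner y (reg_inv \<rho> x k z)"
proof -
  let ?W = "reg_op \<rho> x k" and ?A = "reg_inv \<rho> x k"
  obtain m where m: "m > 0" "\<And>y. m * (norm y)\<^sup>2 \<le> inner (?A y) y"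
    by (rule reg_inv_coercive[OF \<rho>]) (rule that)
  have eq: "(\<forall>x. S (S (?W x)) = x) \<and> (\<forall>x. ?W (S (S x)) = x) \<longleftrightarrow> (\<forall>x. S (S x) = ?A x)" for S
    using reg_op_inverse[OF \<rho>, of x k] reg_inv_inverse[OF \<rho>, of x k] by metis
  have S: "bounded_linear S \<and> (\<forall>x y. inner (S x) y = inner x (S y)) \<and> (\<forall>x. 0 \<le> inner (S x) x)
      \<and> (\<forall>x. S (S x) = ?A x)"
    unfolding S_def op_inv_sqrt_def eq
    by (rule theI'[OF ex1_positive_sqrt[OF bounded_linear_reg_inv[OF \<rho>] reg_inv_symmetric[OF \<rho>] m(2,1)]])
  show "linear S" using S bounded_linear.linear by blast
  show "inner (S y) (S z) = inner y (?A z)"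
    using S by metis
qed

text \<open>\<open>f\<close> stays arbitrary in the induction because the recursion evaluates the
  previous inverse both at \<open>f\<close> and at \<open>X (Suc k)\<close>.\<close>

lemma measurable_reg_inv:
  fixes X :: "nat \<Rightarrow> 'a \<Rightarrow> 'h::{real_inner, second_countable_topology}"
  assumes "\<And>i. i \<in> {1..k} \<Longrightarrow> X i \<in> borel_measurable N" and "f \<in> borel_measurable N"
  shows "(\<lambda>\<omega>. reg_inv \<rho> (\<lambda>i. X i \<omega>) k (f \<omega>)) \<in> borel_measurable N"
  using assms
proof (induction k arbitrary: f)
  case 0
  then show ?case by simp
next
  case (Suc k)
  have [measurable]: "X (Suc k) \<in> borel_measurable N" "f \<in> borel_measurable N"
    using Suc.prems by auto
  have [measurable]: "(\<lambda>\<omega>. reg_inv \<rho> (\<lambda>i. X i \<omega>) k (g \<omega>)) \<in> borel_measurable N"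
    if "g \<in> borel_measurable N" for g
    using Suc.IH[OF _ that] Suc.prems(1) by auto
  show ?case by simp measurable
qed

section \<open>Elementary inequalities\<close>

lemma sums_cosh: "(\<lambda>n. (x\<^sup>2) ^ n / fact (2 * n)) sums cosh x" for x :: real
proof -
  have "(\<lambda>n. if even n then x ^ n /\<^sub>R fact n else 0) sums cosh x"
    by (rule cosh_converges)
  then have "(\<lambda>n. (\<lambda>n. if even n then x ^ n /\<^sub>R fact n else 0) (2 * n)) sums cosh x"
    by (subst sums_mono_reindex[of "\<lambda>n. 2 * n"]) (auto simp: strict_mono_def elim!: evenE)
  then show ?thesis
    by (simp add: power_mult[symmetric] field_simps)
qed

text \<open>\<open>cosh \<circ> sqrt\<close> is a power series with nonnegative coefficients, hence convex.\<close>

lemma cosh_sqrt_convex: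
  fixes p q r \<alpha> :: real
  assumes \<alpha>: "0 \<le> \<alpha>" "\<alpha> \<le> 1" and r: "r\<^sup>2 = \<alpha> * p\<^sup>2 + (1 - \<alpha>) * q\<^sup>2"
  shows "cosh r \<le> \<alpha> * cosh p + (1 - \<alpha>) * cosh q"
proof (rule sums_le[OF _ sums_cosh[of r]])
  show "(\<lambda>n. \<alpha> * ((p\<^sup>2) ^ n / fact (2 * n)) + (1 - \<alpha>) * ((q\<^sup>2) ^ n / fact (2 * n)))
      sums (\<alpha> * cosh p + (1 - \<alpha>) * cosh q)"
    by (intro sums_add sums_mult sums_cosh)
  show "(r\<^sup>2) ^ n / fact (2 * n)
      \<le> \<alpha> * ((p\<^sup>2) ^ n / fact (2 * n)) + (1 - \<alpha>) * ((q\<^sup>2) ^ n / fact (2 * n))" for n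
  proof -
    have "convex_on {0..} (\<lambda>z::real. z ^ n)"
      by (cases "even n") (auto intro: convex_on_subset convex_power_even convex_power_odd)
    from convex_onD[OF this, of \<alpha> "q\<^sup>2" "p\<^sup>2"]
    have "(r\<^sup>2) ^ n \<le> \<alpha> * (p\<^sup>2) ^ n + (1 - \<alpha>) * (q\<^sup>2) ^ n"
      using \<alpha> by (simp add: r add.commute)
    then have "(r\<^sup>2) ^ n / fact (2 * n) \<le> (\<alpha> * (p\<^sup>2) ^ n + (1 - \<alpha>) * (q\<^sup>2) ^ n) / fact (2 * n)"
      by (rule divide_right_mono) simp
    then show ?thesis by (simp add: add_divide_distrib)
  qed
qed

lemma sinh_ge_self: "x \<le> sinh x" if "0 \<le> x" for x :: real
proof -
  have "sinh 0 - 0 \<le> sinh x - x"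
    using that by (intro DERIV_nonneg_imp_nondecreasing[of 0 x "\<lambda>x. sinh x - x"])
      (auto intro!: exI derivative_eq_intros cosh_real_ge_1)
  then show ?thesis by simp
qed

text \<open>Pinelis' inequality: both sides are compared as functions of the cosine of the angle between
  \<open>u\<close> and \<open>h\<close>; the left one is convex and the right one affine, so only parallel vectors matter.\<close>

lemma cosh_norm_add_le:
  fixes u h :: "'h::real_inner"
  shows "cosh (norm (u + h)) \<le> cosh (norm u) + inner u h * (sinh (norm u) / norm u)
    + cosh (norm u) * (exp (norm h) - 1 - norm h)"
proof -
  define a b where "a = norm u" and "b = norm h"
  have ab: "0 \<le> a" "0 \<le> b" by (auto simp: a_def b_def)
  obtain c where c: "inner u h = a * b * c" "\<bar>c\<bar> \<le> 1"
  proof (cases "a * b = 0")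
    case True
    then show ?thesis using that[of 0] by (auto simp: a_def b_def)
  next
    case False
    then show ?thesis
      using that[of "inner u h / (a * b)"] Cauchy_Schwarz_ineq2[of u h] ab
      by (simp add: a_def b_def abs_mult divide_le_eq_1)
  qed
  \<comment> \<open>These weights write \<open>|u + h|^2\<close> as a mixture of the two parallel
    cases: the cross term is \<open>2 a b (2 \<alpha> - 1) = 2 a b c\<close>.\<close>
  define \<alpha> where "\<alpha> = (1 + c) / 2"
  have \<alpha>: "0 \<le> \<alpha>" "\<alpha> \<le> 1" using c(2) by (auto simp: \<alpha>_def)
  have "(norm (u + h))\<^sup>2 = a\<^sup>2 + 2 * (a * b * c) + b\<^sup>2"
    by (simp add: a_def b_def c(1)[symmetric, unfolded a_def b_def] power2_norm_eq_inner
        inner_add_left inner_add_right inner_commute)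
  also have "\<dots> = \<alpha> * (a + b)\<^sup>2 + (1 - \<alpha>) * (a - b)\<^sup>2"
    by (simp add: \<alpha>_def power2_eq_square field_simps)
  finally have "cosh (norm (u + h)) \<le> \<alpha> * cosh (a + b) + (1 - \<alpha>) * cosh (a - b)"
    by (rule cosh_sqrt_convex[OF \<alpha>])
  also have "\<dots> = cosh a * cosh b + c * (sinh a * sinh b)"
    by (simp add: cosh_add cosh_diff \<alpha>_def) (simp add: field_simps)
  also have "\<dots> = cosh a + c * b * sinh a + cosh a * (cosh b - 1) + c * (sinh a * (sinh b - b))"
    by (simp add: algebra_simps)
  \<comment> \<open>Giving up the angle in the term beyond first order lets the hyperbolic functions
    of \<open>b\<close> combine into \<open>exp b\<close>.\<close>
  also have "c * (sinh a * (sinh b - b)) \<le> 1 * (cosh a * (sinh b - b))"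
    using c(2) ab sinh_ge_self[of b] sinh_le_cosh_real[of a] by (intro mult_mono) auto
  also have "cosh a + c * b * sinh a + cosh a * (cosh b - 1) + 1 * (cosh a * (sinh b - b))
      = cosh a + c * b * sinh a + cosh a * (cosh b + sinh b - 1 - b)"
    by (simp add: algebra_simps)
  also have "cosh b + sinh b = exp b" by (rule cosh_plus_sinh)
  \<comment> \<open>For \<open>a = 0\<close> the quotient is 0 by the division convention, and both
    sides vanish.\<close>
  also have "c * b * sinh a = inner u h * (sinh a / a)"
    using c(1) by (cases "a = 0") auto
  finally show ?thesis by (simp add: a_def b_def)
qed

text \<open>The series starts at degree 2, and \<open>r ^ (n + 2) <= r^2\<close> on [0, 1]. The
  factor \<open>r^2\<close> is what later brings in the variance.\<close>

lemma exp_remainder_scale: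
  fixes r y :: real
  assumes "0 \<le> r" "r \<le> 1" "0 \<le> y"
  shows "exp (r * y) - 1 - r * y \<le> r\<^sup>2 * (exp y - 1 - y)"
proof -
  have s: "(\<lambda>n. x ^ (n + 2) /\<^sub>R fact (n + 2)) sums (exp x - 1 - x)" for x :: real
    using sums_split_initial_segment[OF exp_converges[of x], of 2] by (simp add: numeral_2_eq_2 diff_diff_eq)
  show ?thesis
  proof (rule sums_le[OF _ s[of "r * y"] sums_mult[OF s[of y]]])
    fix n
    have "r ^ (n + 2) \<le> r\<^sup>2" using assms by (intro power_decreasing) auto
    then have "r ^ (n + 2) * (y ^ (n + 2) / fact (n + 2)) \<le> r\<^sup>2 * (y ^ (n + 2) / fact (n + 2))"
      using assms by (intro mult_right_mono) auto
    then show "(r * y) ^ (n + 2) /\<^sub>R fact (n + 2) \<le> r\<^sup>2 * (y ^ (n + 2) /\<^sub>R fact (n + 2))"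
      by (simp add: power_mult_distrib divide_inverse mult_ac)
  qed
qed

section \<open>Ville's maximal inequality\<close>

text \<open>Testing the supermartingale property on sets of \<open>F t\<close> with
  \<open>ennreal\<close> values avoids integrability conditions. The induction splits off the
  outcomes that first cross at \<open>Suc n\<close>; those not yet crossed at \<open>n\<close> form
  a set of \<open>F n\<close>.\<close>

lemma (in prob_space) Ville_finite_horizon:
  fixes N :: "nat \<Rightarrow> 'a \<Rightarrow> ennreal"
  assumes sub: "\<And>t. subalgebra M (F t)" and mono: "\<And>s t. s \<le> t \<Longrightarrow> sets (F s) \<subseteq> sets (F t)"
    and N: "\<And>t. N t \<in> borel_measurable (F t)"
    and super: "\<And>t E. E \<in> sets (F t) \<Longrightarrow>
      (\<integral>\<^sup>+\<omega>\<in>E. N (Suc t) \<omega> \<partial>M) \<le> (\<integral>\<^sup>+\<omega>\<in>E. N t \<omega> \<partial>M)"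
  shows "c * emeasure M {\<omega> \<in> space M. \<exists>t\<le>n. c \<le> N t \<omega>} \<le> (\<integral>\<^sup>+\<omega>. N 0 \<omega> \<partial>M)"
proof -
  have sp: "space (F t) = space M" for t using sub by (simp add: subalgebra_def)
  have FM: "sets (F t) \<subseteq> sets M" for t using sub by (simp add: subalgebra_def)
  have NM[measurable]: "N t \<in> borel_measurable M" for t
    using measurable_from_subalg[OF sub N] .
  define H where "H n = {\<omega> \<in> space M. \<exists>t\<le>n. c \<le> N t \<omega>}" for n
  have NF: "N t \<in> borel_measurable (F n)" if "t \<le> n" for t n
    using measurable_mono[OF order_refl refl mono[OF that]] N[of t] sp by blast
  have HF: "H n \<in> sets (F n)" for n
  proof -
    have "H n = (\<Union>t\<in>{..n}. {\<omega> \<in> space (F n). c \<le> N t \<omega>})" by (auto simp: H_def sp)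
    also have "\<dots> \<in> sets (F n)"
      using NF by (intro sets.finite_UN) (auto intro!: borel_measurable_le)
    finally show ?thesis .
  qed
  have [measurable]: "H n \<in> sets M" for n using HF FM by blast
  \<comment> \<open>The left side bounds from below the mean of the process stopped on reaching
    \<open>c\<close>: crossed outcomes count \<open>c\<close>, the others their current
    value.\<close>
  have "c * emeasure M (H n) + (\<integral>\<^sup>+\<omega>\<in>space M - H n. N n \<omega> \<partial>M) \<le> (\<integral>\<^sup>+\<omega>. N 0 \<omega> \<partial>M)"
  proof (induction n)
    case 0
    have "c * emeasure M (H 0) + (\<integral>\<^sup>+\<omega>\<in>space M - H 0. N 0 \<omega> \<partial>M)
        = (\<integral>\<^sup>+\<omega>. c * indicator (H 0) \<omega> + N 0 \<omega> * indicator (space M - H 0) \<omega> \<partial>M)"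
      by (subst nn_integral_add) (auto simp: nn_integral_cmult_indicator)
    also have "\<dots> \<le> (\<integral>\<^sup>+\<omega>. N 0 \<omega> \<partial>M)"
      by (intro nn_integral_mono) (auto simp: H_def split: split_indicator)
    finally show ?case .
  next
    case (Suc n)
    let ?D = "H (Suc n) - H n"
    have sub: "H n \<subseteq> H (Suc n)" by (auto simp: H_def intro: le_SucI)
    have D: "c \<le> N (Suc n) \<omega>" if "\<omega> \<in> ?D" for \<omega>
      using that by (auto simp: H_def le_Suc_eq)
    have "emeasure M (H (Suc n)) = emeasure M (H n) + emeasure M ?D"
      using sub by (subst plus_emeasure) (auto intro: arg_cong[where f = "emeasure M"])
    then have "c * emeasure M (H (Suc n)) + (\<integral>\<^sup>+\<omega>\<in>space M - H (Suc n). N (Suc n) \<omega> \<partial>M)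
        = c * emeasure M (H n) + (\<integral>\<^sup>+\<omega>. c * indicator ?D \<omega>
            + N (Suc n) \<omega> * indicator (space M - H (Suc n)) \<omega> \<partial>M)"
      by (subst nn_integral_add) (auto simp: nn_integral_cmult_indicator distrib_left add.assoc)
    also have "\<dots> \<le> c * emeasure M (H n) + (\<integral>\<^sup>+\<omega>\<in>space M - H n. N (Suc n) \<omega> \<partial>M)"
      using sub by (intro add_left_mono nn_integral_mono) (auto split: split_indicator simp: D)
    also have "\<dots> \<le> c * emeasure M (H n) + (\<integral>\<^sup>+\<omega>\<in>space M - H n. N n \<omega> \<partial>M)"
      using HF[of n] sp[of n] by (intro add_left_mono super) (metis sets.compl_sets)
    finally show ?case using Suc.IH by (rule order_trans)
  qed
  then show ?thesis
    unfolding H_def[symmetric] by (rule order_trans[rotated]) (simp add: add_increasing2)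
qed

text \<open>A supremum equal to \<open>c\<close> need not be attained, but every level
  \<open>d < c\<close> is exceeded at a finite time; then \<open>d\<close> tends to
  \<open>c\<close>.\<close>

lemma (in prob_space) Ville_SUP:
  fixes N :: "nat \<Rightarrow> 'a \<Rightarrow> ennreal" and c :: real
  assumes sub: "\<And>t. subalgebra M (F t)" and mono: "\<And>s t. s \<le> t \<Longrightarrow> sets (F s) \<subseteq> sets (F t)"
    and N: "\<And>t. N t \<in> borel_measurable (F t)"
    and super: "\<And>t E. E \<in> sets (F t) \<Longrightarrow>
      (\<integral>\<^sup>+\<omega>\<in>E. N (Suc t) \<omega> \<partial>M) \<le> (\<integral>\<^sup>+\<omega>\<in>E. N t \<omega> \<partial>M)"
    and init: "(\<integral>\<^sup>+\<omega>. N 0 \<omega> \<partial>M) \<le> 1" and c: "c > 0"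
  shows "prob {\<omega> \<in> space M. ennreal c \<le> (SUP t. N t \<omega>)} \<le> 1 / c"
proof -
  have [measurable]: "N t \<in> borel_measurable M" for t
    using measurable_from_subalg[OF sub N] .
  let ?A = "{\<omega> \<in> space M. ennreal c \<le> (SUP t. N t \<omega>)}"
  have *: "d * prob ?A \<le> 1" if d: "0 < d" "d < c" for d
  proof -
    define H where "H n = {\<omega> \<in> space M. \<exists>t\<le>n. ennreal d \<le> N t \<omega>}" for n
    have [measurable]: "H n \<in> sets M" for n unfolding H_def by measurable
    have "d * prob (H n) \<le> 1" for n
    proof -
      have "ennreal (d * prob (H n)) \<le> 1"
        using Ville_finite_horizon[of F N, OF sub mono N super, of "ennreal d" n] init d
        by (simp add: H_def[symmetric] emeasure_eq_measure ennreal_mult)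
      then show ?thesis by (simp add: ennreal_le_1)
    qed
    moreover have "(\<lambda>n. d * prob (H n)) \<longlonglongrightarrow> d * prob (\<Union>n. H n)"
      by (intro tendsto_mult tendsto_const finite_Lim_measure_incseq)
        (auto simp: incseq_def H_def intro: order_trans)
    ultimately have "d * prob (\<Union>n. H n) \<le> 1"
      by (intro LIMSEQ_le_const2) auto
    moreover have "?A \<subseteq> (\<Union>n. H n)"
    proof
      fix \<omega> assume \<omega>: "\<omega> \<in> ?A"
      then have "ennreal d < (SUP t. N t \<omega>)"
        using d by (auto intro: order.strict_trans2[rotated] simp: ennreal_lessI)
      then obtain t where "ennreal d < N t \<omega>" by (auto simp: less_SUP_iff)
      then show "\<omega> \<in> (\<Union>n. H n)" using \<omega> by (auto simp: H_def intro: less_imp_le)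
    qed
    then have "prob ?A \<le> prob (\<Union>n. H n)" by (intro finite_measure_mono) auto
    ultimately show ?thesis
      using d by (meson mult_left_mono less_imp_le order_trans)
  qed
  have "c * prob ?A \<le> 1"
  proof (rule field_le_mult_one_interval)
    fix z :: real assume "0 < z" "z < 1"
    then show "z * (c * prob ?A) \<le> 1" using *[of "z * c"] c by (simp add: mult.assoc)
  qed
  then show ?thesis using c by (simp add: field_simps)
qed

section \<open>The gamma-exponential mixture\<close>

text \<open>The reciprocal \<open>rGamma\<close> is continuous everywhere;
  \<open>inverse 0 = 0\<close> matches the value of \<open>Gamma\<close> at its poles.\<close>

lemma borel_measurable_Gamma_real [measurable]: "(Gamma :: real \<Rightarrow> real) \<in> borel_measurable borel"
proof -
  have "(rGamma :: real \<Rightarrow> real) \<in> borel_measurable borel"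
    by (intro borel_measurable_continuous_onI continuous_intros)
  then have "(\<lambda>x. inverse (rGamma x) :: real) \<in> borel_measurable borel" by measurable
  then show ?thesis by (simp add: rGamma_inverse_Gamma)
qed

lemma borel_measurable_cosh_real [measurable]: "(cosh :: real \<Rightarrow> real) \<in> borel_measurable borel"
  by (intro borel_measurable_continuous_onI continuous_intros)

lemma borel_measurable_sinh_real [measurable]: "(sinh :: real \<Rightarrow> real) \<in> borel_measurable borel"
  by (intro borel_measurable_continuous_onI continuous_intros)

lemma borel_measurable_reg_upper_gamma [measurable]:
  assumes [measurable]: "f \<in> borel_measurable M" "g \<in> borel_measurable M"
  shows "(\<lambda>\<omega>. reg_upper_gamma (f \<omega>) (g \<omega>)) \<in> borel_measurable M"
proof -
  have "(\<lambda>\<omega>. \<integral>u. (if g \<omega> \<le> u then u powr (f \<omega> - 1) * exp (- u) else 0) \<partial>lborel) \<in> borel_measurable M"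
    by measurable
  moreover have "indicator {g \<omega>..} u *\<^sub>R (u powr (f \<omega> - 1) * exp (- u))
      = (if g \<omega> \<le> u then u powr (f \<omega> - 1) * exp (- u) else 0)" for \<omega> u
    by simp
  ultimately show ?thesis
    unfolding reg_upper_gamma_def set_lebesgue_integral_def by simp
qed

text \<open>The substitution \<open>u = x v\<close> moves the range to \<open>v >= 1\<close>,
  whatever \<open>x\<close> is.\<close>

lemma upper_gamma_scaled:
  assumes "a > 0" "x > 0"
  shows "Gamma a * reg_upper_gamma a x / x powr a
    = (LINT v:{1..}|lborel. v powr (a - 1) * exp (- x * v))"
proof -
  have "Gamma a * reg_upper_gamma a x = (LINT u:{x..}|lborel. u powr (a - 1) * exp (- u))"
    using Gamma_real_pos[OF assms(1)] by (simp add: reg_upper_gamma_def)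
  also have "\<dots> = \<bar>x\<bar> *\<^sub>R (\<integral>v. indicator {x..} (0 + x * v) *\<^sub>R
      ((0 + x * v) powr (a - 1) * exp (- (0 + x * v))) \<partial>lborel)"
    unfolding set_lebesgue_integral_def by (rule lborel_integral_real_affine) (use assms in simp)
  also have "(\<lambda>v. indicator {x..} (0 + x * v) *\<^sub>R
      ((0 + x * v) powr (a - 1) * exp (- (0 + x * v))))
    = (\<lambda>v. x powr (a - 1) * (indicator {1..} v *\<^sub>R (v powr (a - 1) * exp (- x * v))))"
    using assms by (auto simp: fun_eq_iff powr_mult split: split_indicator)
  finally have "Gamma a * reg_upper_gamma a x = (x * x powr (a - 1)) *
      (LINT v:{1..}|lborel. v powr (a - 1) * exp (- x * v))"
    using assms by (simp add: set_lebesgue_integral_def)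
  also have "x * x powr (a - 1) = x powr a"
    using assms powr_mult_base[of x "a - 1"] by simp
  finally show ?thesis using assms by simp
qed

text \<open>A nonintegrable \<open>f\<close> has Bochner integral 0, so the bound survives without
  an integrability hypothesis.\<close>

lemma ennreal_lebesgue_integral_le:
  assumes "\<And>x. 0 \<le> f x"
  shows "ennreal (\<integral>x. f x \<partial>M) \<le> (\<integral>\<^sup>+x. ennreal (f x) \<partial>M)"
proof (cases "integrable M f")
  case True
  then show ?thesis using assms by (simp add: nn_integral_eq_integral)
next
  case False
  then show ?thesis by (simp add: not_integrable_integral_eq)
qed

text \<open>For \<open>b > 0\<close>, the reciprocal of the total mass of
  \<open>mix_weight b\<close>, in the incomplete gamma form of the final bound.\<close>

definition mix_const :: "real \<Rightarrow> real" where
  "mix_const b = b powr b / (Gamma b * reg_upper_gamma b b)"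

text \<open>An unnormalised gamma density of shape and rate \<open>b\<close>, cut to
  \<open>v >= 1\<close>, that is, to nonnegative \<open>\<lambda> = ln v / B\<close>.\<close>

definition mix_weight :: "real \<Rightarrow> real \<Rightarrow> real" where
  "mix_weight b v = indicator {1..} v * (v powr (b - 1) * exp (- b * v))"

lemma mix_weight_nonneg: "0 \<le> mix_weight b v"
  by (simp add: mix_weight_def)

lemma borel_measurable_mix_weight [measurable]: "mix_weight b \<in> borel_measurable borel"
  unfolding mix_weight_def by measurable

lemma mix_const_eq:
  assumes "b > 0"
  shows "mix_const b = 1 / (\<integral>v. mix_weight b v \<partial>lborel)"
proof -
  have "(\<integral>v. mix_weight b v \<partial>lborel) = Gamma b * reg_upper_gamma b b / b powr b"
    unfolding upper_gamma_scaled[OF assms assms] by (simp add: mix_weight_def set_lebesgue_integral_def)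
  then show ?thesis by (simp add: mix_const_def)
qed

lemma mix_const_nonneg: "b > 0 \<Longrightarrow> 0 \<le> mix_const b"
  by (simp add: mix_const_eq integral_nonneg_AE mix_weight_nonneg)

text \<open>If the weight were not integrable, its Bochner integral and hence \<^const>\<open>mix_const\<close> would be
  the junk value 0; so integrability need not be established.\<close>

lemma mix_const_mult_le_1:
  assumes "b > 0"
  shows "ennreal (mix_const b) * (\<integral>\<^sup>+v. ennreal (mix_weight b v) \<partial>lborel) \<le> 1"
proof (cases "integrable lborel (mix_weight b)")
  case True
  let ?J = "\<integral>v. mix_weight b v \<partial>lborel"
  have J: "?J \<ge> 0" by (simp add: integral_nonneg_AE mix_weight_nonneg)
  have "(\<integral>\<^sup>+v. ennreal (mix_weight b v) \<partial>lborel) = ennreal ?J"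
    using True by (simp add: nn_integral_eq_integral mix_weight_nonneg)
  then have "ennreal (mix_const b) * (\<integral>\<^sup>+v. ennreal (mix_weight b v) \<partial>lborel) = ennreal (1 / ?J * ?J)"
    using J assms by (simp add: mix_const_eq ennreal_mult[symmetric])
  also have "\<dots> \<le> 1" by (simp add: ennreal_le_1)
  finally show ?thesis .
next
  case False
  then show ?thesis using assms by (simp add: mix_const_eq not_integrable_integral_eq)
qed

text \<open>With \<open>\<lambda> = ln v / B\<close> the coefficient of \<open>\<nu>\<close> is the
  Bennett function \<open>(exp (\<lambda> B) - 1 - \<lambda> B) / B^2\<close>; in terms of
  \<open>v\<close> it is conjugate to a gamma weight.\<close>

definition tilt :: "real \<Rightarrow> real \<Rightarrow> real \<Rightarrow> real \<Rightarrow> real" where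
  "tilt B v s \<nu> = cosh (ln v / B * s) * exp (- ((v - 1 - ln v) / B\<^sup>2 * \<nu>))"

lemma tilt_nonneg: "0 \<le> tilt B v s \<nu>"
  by (simp add: tilt_def)

text \<open>The weight is conjugate to the tilt: with \<open>v = exp (\<lambda> B)\<close> the mixture of \<open>exp (\<lambda> s - \<nu> \<psi> \<lambda>)\<close> is
  again an incomplete gamma integral. The factor 2 comes from \<open>exp y \<le> 2 cosh y\<close>.\<close>

lemma mixture_le:
  assumes B: "B > 0" and \<theta>: "\<theta> > 0" and s: "s \<ge> 0" and \<nu>: "0 \<le> \<nu>" "\<nu> \<le> \<nu>'"
  defines "b \<equiv> \<theta> / B\<^sup>2" and "a \<equiv> (B * s + \<nu>' + \<theta>) / B\<^sup>2" and "x \<equiv> (\<nu>' + \<theta>) / B\<^sup>2"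
  shows "ennreal (mix_const b * (Gamma a * reg_upper_gamma a x / x powr a) * exp (\<nu>' / B\<^sup>2))
    \<le> 2 * (ennreal (mix_const b) * (\<integral>\<^sup>+v. ennreal (mix_weight b v * tilt B v s \<nu>) \<partial>lborel))"
proof -
  have pos: "a > 0" "x > 0" "b > 0" unfolding a_def x_def b_def using assms by (auto intro!: divide_pos_pos add_nonneg_pos)
  define f where "f v = exp (\<nu>' / B\<^sup>2) * (indicator {1..} v *\<^sub>R (v powr (a - 1) * exp (- x * v)))" for v :: real
  have f_nonneg: "0 \<le> f v" for v by (simp add: f_def)
  have f_le: "f v \<le> 2 * (mix_weight b v * tilt B v s \<nu>)" for v
  proof (cases "v \<ge> 1")
    case True
    have "f v = exp (\<nu>' / B\<^sup>2 + (a - 1) * ln v - x * v)"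
      using True by (simp add: f_def powr_def exp_add exp_diff exp_minus divide_inverse)
    also have "\<nu>' / B\<^sup>2 + (a - 1) * ln v - x * v
        = ((b - 1) * ln v - b * v) + ln v / B * s - (v - 1 - ln v) / B\<^sup>2 * \<nu>'"
      using B by (simp add: a_def b_def x_def field_simps power2_eq_square)
    \<comment> \<open>The only use of \<open>\<nu> <= \<nu>'\<close>: the coefficient
      \<open>v - 1 - ln v\<close> is nonnegative.\<close>
    also have "exp \<dots> \<le> exp (((b - 1) * ln v - b * v) + ln v / B * s - (v - 1 - ln v) / B\<^sup>2 * \<nu>)"
      using True \<nu> ln_le_minus_one[of v] by (simp add: mult_left_mono divide_right_mono)
    also have "\<dots> = mix_weight b v * (exp (ln v / B * s) * exp (- ((v - 1 - ln v) / B\<^sup>2 * \<nu>)))"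
      using True by (simp add: mix_weight_def powr_def exp_add[symmetric])
    also have "exp (ln v / B * s) \<le> 2 * cosh (ln v / B * s)"
      by (simp add: cosh_def)
    finally show ?thesis
      by (simp add: tilt_def mix_weight_nonneg mult_left_mono mult_right_mono mult_ac)
  next
    case False
    then show ?thesis by (simp add: f_def mix_weight_def)
  qed
  have "ennreal (mix_const b * (Gamma a * reg_upper_gamma a x / x powr a) * exp (\<nu>' / B\<^sup>2))
      = ennreal (mix_const b) * ennreal (\<integral>v. f v \<partial>lborel)"
    unfolding upper_gamma_scaled[OF pos(1,2)] set_lebesgue_integral_def f_def integral_mult_right_zero
    using mix_const_nonneg[OF pos(3)]
    by (subst ennreal_mult[symmetric]) (auto simp: integral_nonneg_AE mult_ac)
  also have "\<dots> \<le> ennreal (mix_const b) * (\<integral>\<^sup>+v. ennreal (f v) \<partial>lborel)"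
    by (intro mult_left_mono ennreal_lebesgue_integral_le f_nonneg) simp
  also have "\<dots> \<le> ennreal (mix_const b) * (\<integral>\<^sup>+v. 2 * ennreal (mix_weight b v * tilt B v s \<nu>) \<partial>lborel)"
    using f_le mix_weight_nonneg tilt_nonneg
    by (intro mult_left_mono nn_integral_mono)
      (auto simp: ennreal_mult[symmetric] ennreal_numeral[symmetric] simp del: ennreal_numeral intro!: ennreal_leI)
  also have "\<dots> = 2 * (ennreal (mix_const b) * (\<integral>\<^sup>+v. ennreal (mix_weight b v * tilt B v s \<nu>) \<partial>lborel))"
    by (subst nn_integral_cmult) (auto simp: tilt_def mult_ac)
  finally show ?thesis .
qed

section \<open>The supermartingale\<close>

text \<open>Hypotheses for \<open>t >= 1\<close> are restated at \<open>Suc t\<close>, so the past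
  is \<open>F t\<close> and no natural subtraction occurs.\<close>

locale bounded_noise = prob_space M
  for M :: "'a measure" and F :: "nat \<Rightarrow> 'a measure"
    and X :: "nat \<Rightarrow> 'a \<Rightarrow> 'h::{real_inner, complete_space, second_countable_topology}"
    and \<epsilon> :: "nat \<Rightarrow> 'a \<Rightarrow> real" and B \<sigma>2 \<rho> :: real +
  assumes filt_sub: "\<And>t. subalgebra M (F t)"
    and filt_mono: "\<And>s t. s \<le> t \<Longrightarrow> sets (F s) \<subseteq> sets (F t)"
    and X_meas: "\<And>t. X (Suc t) \<in> borel_measurable (F t)"
    and eps_meas: "\<And>t. \<epsilon> (Suc t) \<in> borel_measurable (F (Suc t))"
    and eps_mean: "\<And>t. AE \<omega> in M. real_cond_exp M (F t) (\<epsilon> (Suc t)) \<omega> = 0"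
    and eps_bdd: "\<And>t \<omega>. \<omega> \<in> space M \<Longrightarrow> \<bar>\<epsilon> (Suc t) \<omega>\<bar> \<le> B"
    and B_pos: "B > 0"
    and eps_var: "\<And>t. AE \<omega> in M. real_cond_exp M (F t)
      (\<lambda>\<omega>'. (\<epsilon> (Suc t) \<omega>' - real_cond_exp M (F t) (\<epsilon> (Suc t)) \<omega>')\<^sup>2) \<omega> = \<sigma>2"
    and rho_pos: "\<rho> > 0"
begin

lemma sub_F: "subalgebra (F t) (F s)" if "s \<le> t"
  using filt_sub[of s] filt_sub[of t] filt_mono[OF that] by (simp add: subalgebra_def)

lemma measurable_F_mono: "f \<in> borel_measurable (F s) \<Longrightarrow> s \<le> t \<Longrightarrow> f \<in> borel_measurable (F t)"
  using measurable_from_subalg[OF sub_F] .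

lemma measurable_F_M: "f \<in> borel_measurable (F s) \<Longrightarrow> f \<in> borel_measurable M"
  using measurable_from_subalg[OF filt_sub] .

lemma sigma_finite_subalgebra_F: "sigma_finite_subalgebra M (F t)"
proof -
  interpret finite_measure_subalgebra M "F t"
    by unfold_locales (rule filt_sub)
  show ?thesis by unfold_locales
qed

section \<open>Integrating the noise and its square against predictable weights\<close>

lemma integrable_bounded:
  fixes f :: "'a \<Rightarrow> real"
  assumes "f \<in> borel_measurable M" "\<And>\<omega>. \<omega> \<in> space M \<Longrightarrow> \<bar>f \<omega>\<bar> \<le> K"
  shows "integrable M f"
  using assms by (intro integrable_const_bound[of _ K]) auto

lemma eps_M: "\<epsilon> (Suc t) \<in> borel_measurable M"
  by (rule measurable_F_M[OF eps_meas])

lemma integral_mult_eps: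
  assumes f: "f \<in> borel_measurable (F t)" and K: "\<And>\<omega>. \<omega> \<in> space M \<Longrightarrow> \<bar>f \<omega>\<bar> \<le> K"
  shows "integrable M (\<lambda>\<omega>. f \<omega> * \<epsilon> (Suc t) \<omega>)" "(\<integral>\<omega>. f \<omega> * \<epsilon> (Suc t) \<omega> \<partial>M) = 0"
proof -
  interpret sigma_finite_subalgebra M "F t" by (rule sigma_finite_subalgebra_F)
  note [measurable] = measurable_F_M[OF f] eps_M
  show int: "integrable M (\<lambda>\<omega>. f \<omega> * \<epsilon> (Suc t) \<omega>)"
    using K eps_bdd B_pos
    by (intro integrable_bounded[of _ "K * B"]) (auto simp: abs_mult intro!: mult_mono intro: order_trans[OF abs_ge_zero])
  have "(\<integral>\<omega>. f \<omega> * \<epsilon> (Suc t) \<omega> \<partial>M) = (\<integral>\<omega>. f \<omega> * real_cond_exp M (F t) (\<epsilon> (Suc t)) \<omega> \<partial>M)"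
    by (rule real_cond_exp_intg(2)[OF int f eps_M, symmetric])
  also have "\<dots> = (\<integral>\<omega>. 0 \<partial>M)"
    using eps_mean[of t] by (intro integral_cong_AE) (auto intro: measurable_F_M)
  finally show "(\<integral>\<omega>. f \<omega> * \<epsilon> (Suc t) \<omega> \<partial>M) = 0" by simp
qed

text \<open>The conditional mean vanishes almost everywhere, so the centred square in the variance
  hypothesis may be replaced by the plain square.\<close>

lemma integral_mult_eps_sq:
  assumes f: "f \<in> borel_measurable (F t)" and K: "\<And>\<omega>. \<omega> \<in> space M \<Longrightarrow> \<bar>f \<omega>\<bar> \<le> K"
  shows "integrable M (\<lambda>\<omega>. f \<omega> * (\<epsilon> (Suc t) \<omega>)\<^sup>2)"
    "(\<integral>\<omega>. f \<omega> * (\<epsilon> (Suc t) \<omega>)\<^sup>2 \<partial>M) = (\<integral>\<omega>. f \<omega> * \<sigma>2 \<partial>M)"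
proof -
  interpret sigma_finite_subalgebra M "F t" by (rule sigma_finite_subalgebra_F)
  note [measurable] = measurable_F_M[OF f] eps_M
  let ?c = "real_cond_exp M (F t) (\<epsilon> (Suc t))"
  have [measurable]: "?c \<in> borel_measurable M" by (intro measurable_F_M[of _ t]) simp
  show int: "integrable M (\<lambda>\<omega>. f \<omega> * (\<epsilon> (Suc t) \<omega>)\<^sup>2)"
    using K eps_bdd B_pos
    by (intro integrable_bounded[of _ "K * B\<^sup>2"])
      (auto simp: abs_mult abs_le_square_iff[symmetric] intro!: mult_mono intro: order_trans[OF abs_ge_zero])
  have eq: "AE \<omega> in M. f \<omega> * (\<epsilon> (Suc t) \<omega>)\<^sup>2 = f \<omega> * (\<epsilon> (Suc t) \<omega> - ?c \<omega>)\<^sup>2"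
    using eps_mean[of t] by eventually_elim simp
  then have int': "integrable M (\<lambda>\<omega>. f \<omega> * (\<epsilon> (Suc t) \<omega> - ?c \<omega>)\<^sup>2)"
    using int by (subst integrable_cong_AE[symmetric]) auto
  have "(\<integral>\<omega>. f \<omega> * (\<epsilon> (Suc t) \<omega>)\<^sup>2 \<partial>M) = (\<integral>\<omega>. f \<omega> * (\<epsilon> (Suc t) \<omega> - ?c \<omega>)\<^sup>2 \<partial>M)"
    using eq by (intro integral_cong_AE) auto
  also have "\<dots> = (\<integral>\<omega>. f \<omega> * real_cond_exp M (F t) (\<lambda>\<omega>. (\<epsilon> (Suc t) \<omega> - ?c \<omega>)\<^sup>2) \<omega> \<partial>M)"
    by (rule real_cond_exp_intg(2)[OF int' f, symmetric]) measurable
  also have "\<dots> = (\<integral>\<omega>. f \<omega> * \<sigma>2 \<partial>M)"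
    using eps_var[of t] by (intro integral_cong_AE) (auto intro: measurable_F_M)
  finally show "(\<integral>\<omega>. f \<omega> * (\<epsilon> (Suc t) \<omega>)\<^sup>2 \<partial>M) = (\<integral>\<omega>. f \<omega> * \<sigma>2 \<partial>M)" .
qed

text \<open>\<open>\<sigma>2\<close> is given only as a real number; the weight 1 identifies it with
  the second moment of \<open>\<epsilon> 1\<close>.\<close>

lemma var_nonneg: "\<sigma>2 \<ge> 0"
proof -
  have "0 \<le> (\<integral>\<omega>. 1 * (\<epsilon> (Suc 0) \<omega>)\<^sup>2 \<partial>M)" by simp
  also have "\<dots> = (\<integral>\<omega>. 1 * \<sigma>2 \<partial>M)"
    by (rule integral_mult_eps_sq(2)[where K = 1]) auto
  finally show ?thesis by (simp add: prob_space)
qed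

section \<open>The whitened noise sum and its measurability\<close>

definition whiten :: "nat \<Rightarrow> 'a \<Rightarrow> 'h \<Rightarrow> 'h" where
  "whiten t \<omega> = op_inv_sqrt (reg_op \<rho> (\<lambda>i. X i \<omega>) t)"

definition noise_sum :: "nat \<Rightarrow> 'a \<Rightarrow> 'h" where
  "noise_sum t \<omega> = (\<Sum>i\<in>{1..t}. \<epsilon> i \<omega> *\<^sub>R X i \<omega>)"

definition stat :: "nat \<Rightarrow> 'a \<Rightarrow> real" where
  "stat t \<omega> = norm (whiten t \<omega> (noise_sum t \<omega>))"

definition gain :: "nat \<Rightarrow> 'a \<Rightarrow> real" where
  "gain t \<omega> = norm (whiten t \<omega> (X t \<omega>))"

definition total_gain :: "nat \<Rightarrow> 'a \<Rightarrow> real" where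
  "total_gain t \<omega> = (\<Sum>i\<in>{1..t}. (gain i \<omega>)\<^sup>2)"

lemma linear_whiten: "linear (whiten t \<omega>)"
  unfolding whiten_def by (rule op_inv_sqrt_reg_op(1)[OF rho_pos])

text \<open>Passing to \<open>reg_inv\<close> removes the square root, so monotonicity and
  measurability need only the explicit recursion.\<close>

lemma inner_whiten: "inner (whiten t \<omega> y) (whiten t \<omega> z) = inner y (reg_inv \<rho> (\<lambda>i. X i \<omega>) t z)"
  unfolding whiten_def by (rule op_inv_sqrt_reg_op(2)[OF rho_pos])

lemma norm_whiten: "norm (whiten t \<omega> y) = sqrt (inner y (reg_inv \<rho> (\<lambda>i. X i \<omega>) t y))"
  unfolding norm_eq_sqrt_inner inner_whiten ..

lemma norm_whiten_Suc_le: "norm (whiten (Suc t) \<omega> y) \<le> norm (whiten t \<omega> y)"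
  unfolding norm_whiten by (intro real_sqrt_le_mono reg_inv_Suc_le rho_pos)

lemma gain_Suc_le_1: "gain (Suc t) \<omega> \<le> 1"
  unfolding gain_def norm_whiten
  using reg_inv_self_le_1[OF rho_pos, of "\<lambda>i. X i \<omega>" t] by (simp del: reg_inv.simps)

lemma gain_nonneg: "0 \<le> gain t \<omega>"
  by (simp add: gain_def)

lemma total_gain_nonneg: "0 \<le> total_gain t \<omega>"
  by (simp add: total_gain_def sum_nonneg)

text \<open>Everything on the right except \<open>\<epsilon> (Suc t)\<close> is determined by the
  past.\<close>

lemma whiten_noise_sum_Suc:
  "whiten (Suc t) \<omega> (noise_sum (Suc t) \<omega>)
    = whiten (Suc t) \<omega> (noise_sum t \<omega>) + \<epsilon> (Suc t) \<omega> *\<^sub>R whiten (Suc t) \<omega> (X (Suc t) \<omega>)"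
  by (simp add: noise_sum_def linear_add[OF linear_whiten] linear_cmul[OF linear_whiten])

text \<open>A deterministic bound, used to make the weights in the one-step argument
  bounded.\<close>

lemma stat_le:
  assumes "\<omega> \<in> space M"
  shows "stat t \<omega> \<le> real t * B"
proof (induction t)
  case 0
  then show ?case by (simp add: stat_def noise_sum_def linear_0[OF linear_whiten])
next
  case (Suc t)
  have "stat (Suc t) \<omega> \<le> norm (whiten (Suc t) \<omega> (noise_sum t \<omega>)) + \<bar>\<epsilon> (Suc t) \<omega>\<bar> * gain (Suc t) \<omega>"
    unfolding stat_def whiten_noise_sum_Suc gain_def by (rule order_trans[OF norm_triangle_ineq]) simp
  also have "\<dots> \<le> stat t \<omega> + B * 1"
    unfolding stat_def using eps_bdd[OF assms] gain_Suc_le_1 gain_nonneg B_pos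
    by (intro add_mono norm_whiten_Suc_le mult_mono) auto
  finally show ?case using Suc by (simp add: algebra_simps)
qed

lemma X_F: "i \<in> {1..Suc t} \<Longrightarrow> X i \<in> borel_measurable (F t)"
  using measurable_F_mono[OF X_meas[of "i - 1"], of t] by auto

lemma eps_F: "i \<in> {1..t} \<Longrightarrow> \<epsilon> i \<in> borel_measurable (F t)"
  using measurable_F_mono[OF eps_meas[of "i - 1"], of t] by auto

lemma noise_sum_measurable: "noise_sum t \<in> borel_measurable (F t)"
  unfolding noise_sum_def
  by (intro borel_measurable_sum borel_measurable_scaleR X_F eps_F) auto

text \<open>Predictability allows \<open>s = Suc t\<close>: the operator then involves
  \<open>X\<close> up to \<open>Suc t\<close>, all \<open>F t\<close>-measurable.\<close>

lemma whiten_inner_measurable: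
  assumes "f \<in> borel_measurable (F t)" "g \<in> borel_measurable (F t)" "s \<le> Suc t"
  shows "(\<lambda>\<omega>. inner (whiten s \<omega> (f \<omega>)) (whiten s \<omega> (g \<omega>))) \<in> borel_measurable (F t)"
  unfolding inner_whiten using assms
  by (intro borel_measurable_inner measurable_reg_inv X_F) auto

lemma whiten_norm_measurable:
  assumes "f \<in> borel_measurable (F t)" "s \<le> Suc t"
  shows "(\<lambda>\<omega>. norm (whiten s \<omega> (f \<omega>))) \<in> borel_measurable (F t)"
  using whiten_inner_measurable[OF assms(1,1,2)] unfolding norm_eq_sqrt_inner by measurable

lemma stat_measurable: "stat t \<in> borel_measurable (F t)"
  unfolding stat_def by (intro whiten_norm_measurable noise_sum_measurable) simp

lemma gain_measurable: "i \<in> {1..Suc t} \<Longrightarrow> gain i \<in> borel_measurable (F t)"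
  unfolding gain_def by (intro whiten_norm_measurable X_F) auto

lemma total_gain_Suc_measurable: "total_gain (Suc t) \<in> borel_measurable (F t)"
  unfolding total_gain_def by (intro borel_measurable_sum borel_measurable_power gain_measurable)

lemma total_gain_measurable: "total_gain t \<in> borel_measurable (F t)"
  unfolding total_gain_def by (intro borel_measurable_sum borel_measurable_power gain_measurable) auto

section \<open>The one-step bound for a fixed tilt\<close>

abbreviation \<psi> :: "real \<Rightarrow> real" where
  "\<psi> v \<equiv> (v - 1 - ln v) / B\<^sup>2"

text \<open>Pinelis' inequality for the scaled vectors, with the exponential remainder made
  quadratic: the bound is a polynomial in the noise with predictable coefficients.\<close>

lemma tilt_step_pointwise:
  fixes t :: nat
  assumes \<omega>: "\<omega> \<in> space M" and v: "v \<ge> 1"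
  defines "l \<equiv> ln v / B" and "U \<equiv> norm (whiten (Suc t) \<omega> (noise_sum t \<omega>))"
    and "e \<equiv> \<epsilon> (Suc t) \<omega>"
  shows "cosh (l * stat (Suc t) \<omega>) \<le> cosh (l * U)
    + l\<^sup>2 * inner (whiten (Suc t) \<omega> (noise_sum t \<omega>)) (whiten (Suc t) \<omega> (X (Suc t) \<omega>))
        * (sinh (l * U) / (l * U)) * e
    + cosh (l * U) * (\<psi> v * (gain (Suc t) \<omega>)\<^sup>2) * e\<^sup>2"
proof -
  let ?u = "whiten (Suc t) \<omega> (noise_sum t \<omega>)" and ?G = "whiten (Suc t) \<omega> (X (Suc t) \<omega>)"
  let ?g = "gain (Suc t) \<omega>"
  have l: "l \<ge> 0" using v B_pos by (simp add: l_def)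
  have n: "norm (l *\<^sub>R ?u + (l * e) *\<^sub>R ?G) = l * stat (Suc t) \<omega>"
    using l by (simp add: stat_def whiten_noise_sum_Suc e_def scaleR_add_right[symmetric]
        scaleR_scaleR[symmetric] del: scaleR_scaleR)
  \<comment> \<open>The increment has norm \<open>r (l B)\<close> with \<open>r\<close> in [0, 1],
    and \<open>exp (l B) = v\<close>; scaling the remainder by \<open>r^2\<close> extracts
    \<open>e^2\<close>.\<close>
  define r where "r = \<bar>e\<bar> * ?g / B"
  have e: "\<bar>e\<bar> \<le> B" unfolding e_def by (rule eps_bdd[OF \<omega>])
  have "\<bar>e\<bar> * ?g \<le> B * 1"
    using e gain_Suc_le_1[of t \<omega>] gain_nonneg[of "Suc t" \<omega>] by (intro mult_mono) auto
  then have r: "0 \<le> r" "r \<le> 1"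
    using B_pos gain_nonneg[of "Suc t" \<omega>] by (auto simp: r_def divide_le_eq)
  have h: "norm ((l * e) *\<^sub>R ?G) = r * (l * B)"
    using l B_pos by (simp add: r_def gain_def abs_mult)
  have "exp (l * B) = v" using v B_pos by (simp add: l_def)
  then have rem: "exp (r * (l * B)) - 1 - r * (l * B) \<le> r\<^sup>2 * (v - 1 - ln v)"
    using exp_remainder_scale[OF r, of "l * B"] l v B_pos by (simp add: l_def)
  have "cosh (l * stat (Suc t) \<omega>) \<le> cosh (l * U)
      + inner (l *\<^sub>R ?u) ((l * e) *\<^sub>R ?G) * (sinh (l * U) / (l * U))
      + cosh (l * U) * (exp (r * (l * B)) - 1 - r * (l * B))"
    using cosh_norm_add_le[of "l *\<^sub>R ?u" "(l * e) *\<^sub>R ?G"] l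
    unfolding n h by (simp add: U_def)
  also have "\<dots> \<le> cosh (l * U)
      + inner (l *\<^sub>R ?u) ((l * e) *\<^sub>R ?G) * (sinh (l * U) / (l * U))
      + cosh (l * U) * (r\<^sup>2 * (v - 1 - ln v))"
    by (intro add_left_mono mult_left_mono rem) simp
  also have "r\<^sup>2 * (v - 1 - ln v) = \<psi> v * ?g\<^sup>2 * e\<^sup>2"
    by (simp add: r_def power_mult_distrib power_divide)
  finally show ?thesis by (simp add: power2_eq_square mult_ac)
qed

text \<open>In the pointwise bound the linear noise term integrates to 0 and the squared noise
  becomes \<open>\<sigma>2\<close>. The resulting factor \<open>1 + z\<close> is paid for by the
  newest term of \<open>total_gain\<close>, which is predictable.\<close>

lemma tilt_step:
  assumes v: "v \<ge> 1" and E: "E \<in> sets (F t)"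
  shows "(\<integral>\<^sup>+\<omega>\<in>E. ennreal (tilt B v (stat (Suc t) \<omega>) (\<sigma>2 * total_gain (Suc t) \<omega>)) \<partial>M)
    \<le> (\<integral>\<^sup>+\<omega>\<in>E. ennreal (tilt B v (stat t \<omega>) (\<sigma>2 * total_gain t \<omega>)) \<partial>M)"
proof -
  define l where "l = ln v / B"
  have l: "l \<ge> 0" using v B_pos by (simp add: l_def)
  have \<psi>: "\<psi> v \<ge> 0" using v ln_le_minus_one[of v] by simp
  define U where "U \<omega> = norm (whiten (Suc t) \<omega> (noise_sum t \<omega>))" for \<omega>
  define J where "J \<omega> = inner (whiten (Suc t) \<omega> (noise_sum t \<omega>)) (whiten (Suc t) \<omega> (X (Suc t) \<omega>))" for \<omega>
  define W where "W \<omega> = indicator E \<omega> * exp (- (\<psi> v * (\<sigma>2 * total_gain (Suc t) \<omega>)))" for \<omega>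
  define C where "C \<omega> = W \<omega> * cosh (l * U \<omega>)" for \<omega>
  define D where "D \<omega> = W \<omega> * (l\<^sup>2 * J \<omega> * (sinh (l * U \<omega>) / (l * U \<omega>)))" for \<omega>
  define R where "R \<omega> = C \<omega> * (\<psi> v * (gain (Suc t) \<omega>)\<^sup>2)" for \<omega>
  note [measurable] = E
  have [measurable]: "U \<in> borel_measurable (F t)" "J \<in> borel_measurable (F t)"
    unfolding U_def J_def
    by (auto intro!: whiten_norm_measurable whiten_inner_measurable noise_sum_measurable X_F)
  note [measurable] = total_gain_Suc_measurable[of t]
  have [measurable]: "gain (Suc t) \<in> borel_measurable (F t)" by (rule gain_measurable) simp
  have [measurable]: "W \<in> borel_measurable (F t)" unfolding W_def by measurable
  have C_F[measurable]: "C \<in> borel_measurable (F t)" unfolding C_def by measurable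
  have D_F: "D \<in> borel_measurable (F t)" unfolding D_def by measurable
  have R_F: "R \<in> borel_measurable (F t)" unfolding R_def by measurable
  have W: "0 \<le> W \<omega>" "W \<omega> \<le> 1" for \<omega>
    using mult_nonneg_nonneg[OF \<psi> mult_nonneg_nonneg[OF var_nonneg total_gain_nonneg[of "Suc t" \<omega>]]]
    by (auto simp: W_def split: split_indicator)
  have U: "0 \<le> U \<omega>" "U \<omega> \<le> stat t \<omega>" for \<omega>
    by (auto simp: U_def stat_def norm_whiten_Suc_le)
  define c where "c = cosh (l * (real t * B))"
  have cU: "cosh (l * U \<omega>) \<le> c" if "\<omega> \<in> space M" for \<omega>
    unfolding c_def using U[of \<omega>] stat_le[OF that, of t] l B_pos
    by (subst cosh_real_nonneg_le_iff) (auto intro!: mult_left_mono)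
  have C: "0 \<le> C \<omega>" for \<omega> using W by (simp add: C_def)
  have C_le: "\<bar>C \<omega>\<bar> \<le> c" if "\<omega> \<in> space M" for \<omega>
    using mult_mono[OF W(2) cU[OF that]] W(1) C[of \<omega>] by (simp add: C_def)
  have g: "(gain (Suc t) \<omega>)\<^sup>2 \<le> 1" for \<omega>
    using gain_nonneg gain_Suc_le_1 by (simp add: power_le_one)
  have R: "0 \<le> R \<omega>" for \<omega>
    unfolding R_def by (intro mult_nonneg_nonneg C \<psi>) simp
  have R_le: "\<bar>R \<omega>\<bar> \<le> c * (\<psi> v * 1)" if "\<omega> \<in> space M" for \<omega>
  proof -
    have "\<bar>R \<omega>\<bar> = \<bar>C \<omega>\<bar> * (\<psi> v * (gain (Suc t) \<omega>)\<^sup>2)"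
      unfolding R_def abs_mult abs_of_nonneg[OF \<psi>] by simp
    also have "\<dots> \<le> c * (\<psi> v * 1)"
      using C_le[OF that] \<psi> g[of \<omega>] mult_nonneg_nonneg[OF \<psi> zero_le_power2[of "gain (Suc t) \<omega>"]]
      by (intro mult_mono mult_left_mono) auto
    finally show ?thesis .
  qed
  \<comment> \<open>At \<open>l * U \<omega> = 0\<close> the division convention makes
    \<open>D\<close> zero; elsewhere Cauchy--Schwarz cancels the denominator.\<close>
  have D_le: "\<bar>D \<omega>\<bar> \<le> l * c" if "\<omega> \<in> space M" for \<omega>
  proof (cases "l * U \<omega> = 0")
    case True
    then have "D \<omega> = 0" by (auto simp: D_def)
    then show ?thesis using l by (simp add: c_def)
  next
    case False
    then have pos: "l > 0" "U \<omega> > 0" using l U(1)[of \<omega>] by auto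
    have "\<bar>J \<omega>\<bar> \<le> U \<omega> * gain (Suc t) \<omega>"
      unfolding J_def U_def gain_def by (rule Cauchy_Schwarz_ineq2)
    also have "\<dots> \<le> U \<omega> * 1"
      by (intro mult_left_mono gain_Suc_le_1 U)
    finally have J: "\<bar>J \<omega>\<bar> \<le> U \<omega>" by simp
    have "\<bar>D \<omega>\<bar> = W \<omega> * (l * (\<bar>J \<omega>\<bar> / U \<omega>) * sinh (l * U \<omega>))"
      using pos W(1)[of \<omega>] by (simp add: D_def abs_mult power2_eq_square)
    also have "\<dots> \<le> 1 * (l * 1 * c)"
      using pos W[of \<omega>] J order_trans[OF less_imp_le[OF sinh_less_cosh_real] cU[OF that]]
      by (intro mult_mono) (auto simp: c_def)
    finally show ?thesis by simp
  qed
  note De = integral_mult_eps[OF D_F D_le] and Re = integral_mult_eps_sq[OF R_F R_le]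
  have C_int: "integrable M C"
    by (rule integrable_bounded[OF measurable_F_M[OF C_F] C_le])
  have R_int: "integrable M R"
    by (rule integrable_bounded[OF measurable_F_M[OF R_F] R_le])
  define L where "L \<omega> = C \<omega> + D \<omega> * \<epsilon> (Suc t) \<omega> + R \<omega> * (\<epsilon> (Suc t) \<omega>)\<^sup>2" for \<omega>
  have L_int: "integrable M L"
    unfolding L_def by (intro Bochner_Integration.integrable_add C_int De Re)
  have L_ge: "indicator E \<omega> * tilt B v (stat (Suc t) \<omega>) (\<sigma>2 * total_gain (Suc t) \<omega>) \<le> L \<omega>"
    if "\<omega> \<in> space M" for \<omega>
  proof -
    have "indicator E \<omega> * tilt B v (stat (Suc t) \<omega>) (\<sigma>2 * total_gain (Suc t) \<omega>)
        = W \<omega> * cosh (l * stat (Suc t) \<omega>)"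
      by (simp add: tilt_def W_def l_def)
    also have "\<dots> \<le> L \<omega>"
      using mult_left_mono[OF tilt_step_pointwise[OF that v, of t] W(1)[of \<omega>]]
      by (simp add: L_def C_def D_def R_def U_def J_def l_def algebra_simps)
    finally show ?thesis .
  qed
  \<comment> \<open>\<open>L\<close> contains a signed noise term, but it dominates a nonnegative
    tilt, so its two integrals agree.\<close>
  have L_nonneg: "0 \<le> L \<omega>" if "\<omega> \<in> space M" for \<omega>
    by (rule order_trans[OF _ L_ge[OF that]]) (simp add: tilt_nonneg)
  have "(\<integral>\<^sup>+\<omega>\<in>E. ennreal (tilt B v (stat (Suc t) \<omega>) (\<sigma>2 * total_gain (Suc t) \<omega>)) \<partial>M)
      \<le> (\<integral>\<^sup>+\<omega>. ennreal (L \<omega>) \<partial>M)"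
  proof (rule nn_integral_mono)
    fix \<omega> assume "\<omega> \<in> space M"
    then show "ennreal (tilt B v (stat (Suc t) \<omega>) (\<sigma>2 * total_gain (Suc t) \<omega>)) * indicator E \<omega>
        \<le> ennreal (L \<omega>)"
      using L_ge[of \<omega>] by (auto split: split_indicator_asm split_indicator intro!: ennreal_leI)
  qed
  also have "\<dots> = ennreal (\<integral>\<omega>. L \<omega> \<partial>M)"
    using L_nonneg by (intro nn_integral_eq_integral L_int) auto
  also have "(\<integral>\<omega>. L \<omega> \<partial>M) = (\<integral>\<omega>. C \<omega> + R \<omega> * \<sigma>2 \<partial>M)"
    unfolding L_def using C_int R_int De Re by simp
  also have "ennreal \<dots> = (\<integral>\<^sup>+\<omega>. ennreal (C \<omega> + R \<omega> * \<sigma>2) \<partial>M)"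
    using C R var_nonneg C_int R_int
    by (intro nn_integral_eq_integral[symmetric] Bochner_Integration.integrable_add
        integrable_mult_left AE_I2) auto
  also have "\<dots> \<le> (\<integral>\<^sup>+\<omega>\<in>E. ennreal (tilt B v (stat t \<omega>) (\<sigma>2 * total_gain t \<omega>)) \<partial>M)"
  proof (rule nn_integral_mono)
    fix \<omega> assume \<omega>: "\<omega> \<in> space M"
    let ?z = "\<psi> v * (\<sigma>2 * (gain (Suc t) \<omega>)\<^sup>2)"
    have "C \<omega> + R \<omega> * \<sigma>2 = C \<omega> * (1 + ?z)" by (simp add: R_def algebra_simps)
    also have "\<dots> \<le> C \<omega> * exp ?z"
      by (intro mult_left_mono exp_ge_add_one_self C)
    also have "\<dots> = indicator E \<omega> * (cosh (l * U \<omega>) * exp (- (\<psi> v * (\<sigma>2 * total_gain t \<omega>))))"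
      by (simp add: C_def W_def total_gain_def exp_add[symmetric] algebra_simps)
    also have "cosh (l * U \<omega>) \<le> cosh (l * stat t \<omega>)"
      using U[of \<omega>] l by (subst cosh_real_nonneg_le_iff) (auto intro!: mult_left_mono)
    finally have "C \<omega> + R \<omega> * \<sigma>2 \<le> indicator E \<omega> * tilt B v (stat t \<omega>) (\<sigma>2 * total_gain t \<omega>)"
      by (simp add: tilt_def l_def mult_left_mono)
    then show "ennreal (C \<omega> + R \<omega> * \<sigma>2)
        \<le> ennreal (tilt B v (stat t \<omega>) (\<sigma>2 * total_gain t \<omega>)) * indicator E \<omega>"
      by (auto split: split_indicator intro!: ennreal_leI simp: ennreal_neg)
  qed
  finally show ?thesis .
qed

section \<open>Mixing over the tilt\<close>

definition mixture :: "real \<Rightarrow> nat \<Rightarrow> 'a \<Rightarrow> ennreal" where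
  "mixture b t \<omega> = ennreal (mix_const b) *
    (\<integral>\<^sup>+v. ennreal (mix_weight b v * tilt B v (stat t \<omega>) (\<sigma>2 * total_gain t \<omega>)) \<partial>lborel)"

lemma mixture_measurable: "mixture b t \<in> borel_measurable (F t)"
proof -
  note [measurable] = stat_measurable[of t] total_gain_measurable[of t]
  show ?thesis unfolding mixture_def tilt_def by measurable
qed

lemma mixture_0: "b > 0 \<Longrightarrow> mixture b 0 \<omega> \<le> 1"
  using mix_const_mult_le_1[of b]
  by (simp add: mixture_def tilt_def stat_def noise_sum_def total_gain_def linear_0[OF linear_whiten])

text \<open>Tonelli's theorem puts the integral over outcomes inside, where the fixed-tilt bound
  applies.\<close>

lemma set_nn_integral_mixture:
  assumes E: "E \<in> sets (F t)"
  shows "(\<integral>\<^sup>+\<omega>\<in>E. mixture b s \<omega> \<partial>M) = ennreal (mix_const b) *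
    (\<integral>\<^sup>+v. ennreal (mix_weight b v) *
      (\<integral>\<^sup>+\<omega>\<in>E. ennreal (tilt B v (stat s \<omega>) (\<sigma>2 * total_gain s \<omega>)) \<partial>M) \<partial>lborel)"
proof -
  interpret pair_sigma_finite lborel M
    by (intro pair_sigma_finite.intro sigma_finite_lborel sigma_finite_measure_axioms)
  note [measurable] = measurable_F_M[OF stat_measurable[of s]] measurable_F_M[OF total_gain_measurable[of s]]
  have [measurable]: "E \<in> sets M" using E filt_sub[of t] by (auto simp: subalgebra_def)
  let ?T = "\<lambda>v \<omega>. tilt B v (stat s \<omega>) (\<sigma>2 * total_gain s \<omega>)"
  have [measurable]: "(\<lambda>(v, \<omega>). ?T v \<omega>) \<in> borel_measurable (lborel \<Otimes>\<^sub>M M)"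
    unfolding tilt_def by measurable
  have "(\<integral>\<^sup>+\<omega>\<in>E. mixture b s \<omega> \<partial>M)
      = (\<integral>\<^sup>+\<omega>. ennreal (mix_const b) * (\<integral>\<^sup>+v. ennreal (mix_weight b v * ?T v \<omega>) * indicator E \<omega> \<partial>lborel) \<partial>M)"
    unfolding mixture_def by (intro nn_integral_cong) (auto split: split_indicator)
  also have "\<dots> = ennreal (mix_const b) * (\<integral>\<^sup>+\<omega>. \<integral>\<^sup>+v. ennreal (mix_weight b v * ?T v \<omega>) * indicator E \<omega> \<partial>lborel \<partial>M)"
    by (rule nn_integral_cmult) measurable
  also have "(\<integral>\<^sup>+\<omega>. \<integral>\<^sup>+v. ennreal (mix_weight b v * ?T v \<omega>) * indicator E \<omega> \<partial>lborel \<partial>M)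
      = (\<integral>\<^sup>+v. \<integral>\<^sup>+\<omega>. ennreal (mix_weight b v * ?T v \<omega>) * indicator E \<omega> \<partial>M \<partial>lborel)"
    by (rule Fubini') measurable
  also have "\<dots> = (\<integral>\<^sup>+v. ennreal (mix_weight b v) * (\<integral>\<^sup>+\<omega>\<in>E. ennreal (?T v \<omega>) \<partial>M) \<partial>lborel)"
    by (intro nn_integral_cong, subst nn_integral_cmult[symmetric])
      (auto simp: ennreal_mult mix_weight_nonneg tilt_nonneg mult_ac)
  finally show ?thesis .
qed

text \<open>The one-step bound covers \<open>v >= 1\<close>; below 1 the weight vanishes.\<close>

lemma mixture_step:
  assumes "E \<in> sets (F t)"
  shows "(\<integral>\<^sup>+\<omega>\<in>E. mixture b (Suc t) \<omega> \<partial>M) \<le> (\<integral>\<^sup>+\<omega>\<in>E. mixture b t \<omega> \<partial>M)"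
  unfolding set_nn_integral_mixture[OF assms]
proof (rule mult_left_mono, rule nn_integral_mono)
  fix v :: real
  show "ennreal (mix_weight b v) * (\<integral>\<^sup>+\<omega>\<in>E. ennreal (tilt B v (stat (Suc t) \<omega>) (\<sigma>2 * total_gain (Suc t) \<omega>)) \<partial>M)
    \<le> ennreal (mix_weight b v) * (\<integral>\<^sup>+\<omega>\<in>E. ennreal (tilt B v (stat t \<omega>) (\<sigma>2 * total_gain t \<omega>)) \<partial>M)"
  proof (cases "v \<ge> 1")
    case True
    then show ?thesis by (intro mult_left_mono tilt_step assms) auto
  next
    case False
    then show ?thesis by (simp add: mix_weight_def)
  qed
qed simp

lemma prob_SUP_mixture:
  assumes "b > 0" "c > 0"
  shows "prob {\<omega> \<in> space M. ennreal c \<le> (SUP t. mixture b t \<omega>)} \<le> 1 / c"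
proof (rule Ville_SUP[of F "mixture b"])
  have "(\<integral>\<^sup>+\<omega>. mixture b 0 \<omega> \<partial>M) \<le> (\<integral>\<^sup>+\<omega>. 1 \<partial>M)"
    by (intro nn_integral_mono mixture_0 assms)
  then show "(\<integral>\<^sup>+\<omega>. mixture b 0 \<omega> \<partial>M) \<le> 1" by (simp add: emeasure_space_1)
qed (use filt_sub filt_mono mixture_measurable mixture_step assms in auto)

end

section \<open>From the true variance to its estimate\<close>

theorem theorem5:
  fixes M :: "'a measure"
    and F :: "nat \<Rightarrow> 'a measure"
    and X :: "nat \<Rightarrow> 'a \<Rightarrow> 'h::{real_inner, complete_space, second_countable_topology}"
    and \<epsilon> :: "nat \<Rightarrow> 'a \<Rightarrow> real"
    and \<sigma>hat :: "nat \<Rightarrow> 'a \<Rightarrow> real"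
    and B \<sigma>2 \<rho> \<delta>1 \<delta>2 \<theta> :: real
  assumes prob: "prob_space M"
    and filt_sub: "\<And>t. subalgebra M (F t)"
    and filt_mono: "\<And>s t. s \<le> t \<Longrightarrow> sets (F s) \<subseteq> sets (F t)"
    and X_meas: "\<And>t. t \<ge> 1 \<Longrightarrow> X t \<in> borel_measurable (F (t - 1))"
    and eps_meas: "\<And>t. t \<ge> 1 \<Longrightarrow> \<epsilon> t \<in> borel_measurable (F t)"
    and eps_mean: "\<And>t. t \<ge> 1 \<Longrightarrow>
         AE \<omega> in M. real_cond_exp M (F (t - 1)) (\<epsilon> t) \<omega> = 0"
    and eps_bdd: "\<And>t \<omega>. t \<ge> 1 \<Longrightarrow> \<omega> \<in> space M \<Longrightarrow> \<bar>\<epsilon> t \<omega>\<bar> \<le> B"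
    and B_pos: "B > 0"
    and eps_var: "\<And>t. t \<ge> 1 \<Longrightarrow>
         AE \<omega> in M. real_cond_exp M (F (t - 1))
             (\<lambda>\<omega>'. (\<epsilon> t \<omega>' - real_cond_exp M (F (t - 1)) (\<epsilon> t) \<omega>')\<^sup>2) \<omega> = \<sigma>2"
    and rho_pos: "\<rho> > 0"
    and d1: "\<delta>1 > 0" and d2: "\<delta>2 > 0" and d12: "\<delta>1 + \<delta>2 < 1"
    and sig_meas: "\<And>t. \<sigma>hat t \<in> borel_measurable M"
    and sig_ub: "measure M {\<omega> \<in> space M. \<forall>t\<ge>1. \<sigma>hat t \<omega> \<ge> \<sigma>2} \<ge> 1 - \<delta>1"
    and theta_pos: "\<theta> > 0"
  shows "measure M {\<omega> \<in> space M.
     (SUP t\<in>{1..}.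
        let V = (\<lambda>k. \<lambda>x. \<rho> *\<^sub>R x + (\<Sum>i\<in>{1..k}. outer (X i \<omega>) (X i \<omega>) x));
            Mt = (\<Sum>i\<in>{1..t}. \<epsilon> i \<omega> *\<^sub>R X i \<omega>);
            G = (\<lambda>i. op_inv_sqrt (V i) (X i \<omega>));
            s = norm (op_inv_sqrt (V t) Mt);
            \<nu> = \<sigma>hat t \<omega> * (\<Sum>i\<in>{1..t}. (norm (G i))\<^sup>2);
            a0 = \<theta> / B\<^sup>2;
            a = (B * s + \<nu> + \<theta>) / B\<^sup>2;
            x = (\<nu> + \<theta>) / B\<^sup>2
        in ereal (a0 powr a0 / (Gamma a0 * reg_upper_gamma a0 a0)
                  * (Gamma a * reg_upper_gamma a x / x powr a)
                  * exp (\<nu> / B\<^sup>2)))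
     < ereal (2 / \<delta>2)} \<ge> 1 - \<delta>1 - \<delta>2"
proof -
  interpret prob_space M by (rule prob)
  interpret bounded_noise M F X \<epsilon> B \<sigma>2 \<rho>
  proof (unfold_locales)
    show "X (Suc t) \<in> borel_measurable (F t)" for t using X_meas[of "Suc t"] by simp
    show "\<epsilon> (Suc t) \<in> borel_measurable (F (Suc t))" for t using eps_meas[of "Suc t"] by simp
    show "AE \<omega> in M. real_cond_exp M (F t) (\<epsilon> (Suc t)) \<omega> = 0" for t using eps_mean[of "Suc t"] by simp
    show "AE \<omega> in M. real_cond_exp M (F t)
      (\<lambda>\<omega>'. (\<epsilon> (Suc t) \<omega>' - real_cond_exp M (F t) (\<epsilon> (Suc t)) \<omega>')\<^sup>2) \<omega> = \<sigma>2" for t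
      using eps_var[of "Suc t"] by simp
  qed (use filt_sub filt_mono eps_bdd B_pos rho_pos in auto)
  define b where "b = \<theta> / B\<^sup>2"
  have b: "b > 0" using theta_pos B_pos by (simp add: b_def)
  define \<nu> where "\<nu> t \<omega> = \<sigma>hat t \<omega> * total_gain t \<omega>" for t \<omega>
  define a where "a t \<omega> = (B * stat t \<omega> + \<nu> t \<omega> + \<theta>) / B\<^sup>2" for t \<omega>
  define x where "x t \<omega> = (\<nu> t \<omega> + \<theta>) / B\<^sup>2" for t \<omega>
  define Y where "Y t \<omega> = mix_const b * (Gamma (a t \<omega>) * reg_upper_gamma (a t \<omega>) (x t \<omega>)
    / x t \<omega> powr a t \<omega>) * exp (\<nu> t \<omega> / B\<^sup>2)" for t \<omega>
  note [measurable] = measurable_F_M[OF stat_measurable] measurable_F_M[OF total_gain_measurable]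
    measurable_F_M[OF mixture_measurable] sig_meas
  have [measurable]: "\<nu> t \<in> borel_measurable M" for t unfolding \<nu>_def by measurable
  have [measurable]: "a t \<in> borel_measurable M" "x t \<in> borel_measurable M" for t
    unfolding a_def x_def by measurable
  have [measurable]: "Y t \<in> borel_measurable M" for t unfolding Y_def by measurable
  let ?A = "{\<omega> \<in> space M. \<forall>t\<ge>1. \<sigma>hat t \<omega> \<ge> \<sigma>2}"
  let ?H = "{\<omega> \<in> space M. ennreal (1 / \<delta>2) \<le> (SUP t. mixture b t \<omega>)}"
  let ?Z = "{\<omega> \<in> space M. (SUP t\<in>{1..}. ereal (Y t \<omega>)) < ereal (2 / \<delta>2)}"
  have H: "prob ?H \<le> \<delta>2"
    using prob_SUP_mixture[OF b, of "1 / \<delta>2"] d2 by simp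
  have "?A - ?H \<subseteq> ?Z"
  proof
    fix \<omega> assume \<omega>: "\<omega> \<in> ?A - ?H"
    then have sup: "(SUP t. mixture b t \<omega>) < ennreal (1 / \<delta>2)" by (auto simp: not_le)
    \<comment> \<open>Bounding every term by the fixed number \<open>2 * c < 2 / \<delta>2\<close>
      keeps the inequality strict after the supremum.\<close>
    then obtain c where c: "c \<ge> 0" "(SUP t. mixture b t \<omega>) = ennreal c" by (cases "SUP t. mixture b t \<omega>") auto
    have "ereal (Y t \<omega>) \<le> ereal (2 * c)" if t: "t \<ge> 1" for t
    proof -
      have le: "\<sigma>2 * total_gain t \<omega> \<le> \<nu> t \<omega>"
        using \<omega> t total_gain_nonneg by (auto simp: \<nu>_def intro!: mult_right_mono)
      have "0 \<le> \<sigma>2 * total_gain t \<omega>" using var_nonneg total_gain_nonneg by simp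
      then have "ennreal (Y t \<omega>) \<le> 2 * mixture b t \<omega>"
        unfolding Y_def mixture_def a_def x_def b_def
        by (intro mixture_le[OF B_pos theta_pos _ _ le]) (simp_all add: stat_def)
      also have "\<dots> \<le> 2 * ennreal c"
        unfolding c(2)[symmetric] by (intro mult_left_mono SUP_upper) auto
      also have "\<dots> = ennreal (2 * c)" using c(1) by (simp add: ennreal_mult)
      finally show ?thesis using c(1) by (simp add: ennreal_le_iff)
    qed
    then have "(SUP t\<in>{1..}. ereal (Y t \<omega>)) \<le> ereal (2 * c)" by (intro SUP_least) auto
    also have "\<dots> < ereal (2 / \<delta>2)"
      using sup c d2 by (simp add: ennreal_less_iff)
    finally show "\<omega> \<in> ?Z" using \<omega> by simp
  qed
  then have "prob (?A - ?H) \<le> prob ?Z" by (intro finite_measure_mono) measurable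
  moreover have "prob ?A - prob ?H \<le> prob (?A - ?H)"
  proof -
    have "prob ?A \<le> prob ((?A - ?H) \<union> ?H)" by (intro finite_measure_mono) (auto, measurable)
    also have "\<dots> \<le> prob (?A - ?H) + prob ?H" by (intro measure_Un_le) measurable
    finally show ?thesis by simp
  qed
  ultimately have "1 - \<delta>1 - \<delta>2 \<le> prob ?Z" using H sig_ub by linarith
  then show ?thesis
    unfolding Let_def Y_def \<nu>_def a_def x_def b_def mix_const_def stat_def total_gain_def gain_def
      whiten_def noise_sum_def reg_op_def .
qed

end
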